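(* Let $d\geq 3$ and let $\Delta$ be a balanced minimal $(d-1)$-cycle complex with proper coloring $\kappa:V(\Delta)\to[d]$. Then for every $T\subseteq[d]$ with $|T|\geq 3$, the graph $G(\Delta_T)$ of the $T$-rank selected subcomplex $\Delta_T=\Delta[\kappa^{-1}(T)]$ is rigid in $\mathbb{R}^{|T|}$.
   Context: Simplicial complexes are finite; $[d]=\{1,\dots,d\}$. $V(\Delta)$, $E(\Delta)$ are the sets of $0$-faces and $1$-faces of $\Delta$, and $G(\Delta)=(V(\Delta),E(\Delta))$ is its graph (1-skeleton). For $W\subseteq V(\Delta)$, $\Delta[W]=\{F\in\Delta: F\subseteq W\}$. For a collection $\mathcal S$ of finite sets, $\langle\mathcal S\rangle=\{G: G\subseteq F \text{ for some } F\in\mathcal S\}$. Minimal cycle complexes. Let $\Gamma$ be an abelian group. On a totally ordered vertex set, an $i$-chain is a formal sum $c=\sum_F a_F F$ of $i$-faces with $a_F\in\Gamma$; $\partial c=\sum_F a_F\,\partial F$, where for $F=\{x_1<\dots<x_{i+1}\}$, $\partial F=\sum_{j=1}^{i+1}(-1)^jF\setminus\{x_j\}$. An $i$-cycle is an $i$-chain $c$ with $\partial c=0$. A chain $c'=\sum b_FF$ is a subchain of $c=\sum a_FF$ if $b_F\in\{0,a_F\}$ for every $F$. An $i$-cycle $c$ is minimal if its only subchains that are $i$-cycles are $c$ and $0$. $\operatorname{supp} c=\{F:a_F\neq0\}$. A $(d-1)$-dimensional simplicial complex $\Delta$ is a minimal $(d-1)$-cycle complex (over $\Gamma$) if either (i)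 $\Delta=\langle\{F\}\rangle$ for a $d$-set $F$, or (ii) $\Delta=\langle\operatorname{supp}c\rangle$ for some nonzero minimal $(d-1)$-cycle $c$ with coefficients in $\Gamma$. Here $\Gamma$ is an arbitrary abelian group. A $(d-1)$-dimensional complex $\Delta$ is balanced if there is a map $\kappa:V(\Delta)\to[d]$ with $|F\cap\kappa^{-1}(i)|\leq1$ for all $F\in\Delta$, $i\in[d]$ (equivalently $G(\Delta)$ is $d$-colorable); $\kappa$ is called a proper coloring. For minimal cycle complexes it is unique up to permutation of colors. Rigidity. A framework $(G,p)$ in $\mathbb{R}^k$ is a finite simple graph $G$ with a map $p:V(G)\to\mathbb{R}^k$. An infinitesimal motion is a map $\dot p:V(G)\to\mathbb{R}^k$ with $(p(i)-p(j))\cdot(\dot p(i)-\dot p(j))=0$ for all $ij\in E(G)$; it is trivial if $\dot p(i)=Sp(i)+t$ for all $i$, for some skew-symmetric $S$ and some $t\in\mathbb{R}^k$. $(G,p)$ is infinitesimally rigid if all its infinitesimal motions are trivial. $G$ is rigid in $\mathbb{R}^k$ if $(G,p)$ is infinitesimally rigid in $\mathbb{R}^k$ for some $p$. *)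

theory Defs
  imports "Jordan_Normal_Form.Matrix"
begin

definition simplicial_complex :: "'a set set \<Rightarrow> bool" where
  "simplicial_complex \<Delta> \<longleftrightarrow>
     finite \<Delta> \<and> (\<forall>F\<in>\<Delta>. finite F) \<and> (\<forall>F\<in>\<Delta>. \<forall>G. G \<subseteq> F \<longrightarrow> G \<in> \<Delta>)"

definition has_dimension :: "'a set set \<Rightarrow> nat \<Rightarrow> bool" where
  "has_dimension \<Delta> i \<longleftrightarrow> (\<forall>F\<in>\<Delta>. card F \<le> i + 1) \<and> (\<exists>F\<in>\<Delta>. card F = i + 1)"

text \<open>A vertex \<open>v\<close> is identified with the face \<open>{v}\<close>.\<close>

definition verts :: "'a set set \<Rightarrow> 'a set" where
  "verts \<Delta> = {v. {v} \<in> \<Delta>}"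

definition edges :: "'a set set \<Rightarrow> 'a set set" where
  "edges \<Delta> = {e \<in> \<Delta>. card e = 2}"

definition graph_of :: "'a set set \<Rightarrow> 'a set \<times> 'a set set" where
  "graph_of \<Delta> = (verts \<Delta>, edges \<Delta>)"

definition induced :: "'a set set \<Rightarrow> 'a set \<Rightarrow> 'a set set" where
  "induced \<Delta> W = {F \<in> \<Delta>. F \<subseteq> W}"

definition generated :: "'a set set \<Rightarrow> 'a set set" where
  "generated S = {G. \<exists>F\<in>S. G \<subseteq> F}"


text \<open>An \<open>i\<close>-chain \<open>\<Sum> a\<^sub>F F\<close> is represented by its coefficient function \<open>F \<mapsto> a\<^sub>F\<close>.\<close>

definition supp :: "('a set \<Rightarrow> 'g::zero) \<Rightarrow> 'a set set" where
  "supp c = {F. c F \<noteq> 0}"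

definition is_chain :: "nat \<Rightarrow> ('a set \<Rightarrow> 'g::zero) \<Rightarrow> bool" where
  "is_chain i c \<longleftrightarrow> finite (supp c) \<and> (\<forall>F\<in>supp c. finite F \<and> card F = i + 1)"

text \<open>If \<open>F = {x\<^sub>1 < \<dots> < x\<^sub>n}\<close> then \<open>card {y \<in> F. y \<le> x\<^sub>j} = j\<close>, so
  \<open>signed_coeff F x\<^sub>j a = (-1)\<^sup>j a\<close>.\<close>

definition signed_coeff :: "'a::linorder set \<Rightarrow> 'a \<Rightarrow> 'g::ab_group_add \<Rightarrow> 'g" where
  "signed_coeff F x a = (if even (card {y \<in> F. y \<le> x}) then a else - a)"

definition boundary :: "('a::linorder set \<Rightarrow> 'g::ab_group_add) \<Rightarrow> 'a set \<Rightarrow> 'g" where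
  "boundary c G =
     (\<Sum>F\<in>supp c. \<Sum>x\<in>F. if F - {x} = G then signed_coeff F x (c F) else 0)"

definition is_cycle :: "nat \<Rightarrow> ('a::linorder set \<Rightarrow> 'g::ab_group_add) \<Rightarrow> bool" where
  "is_cycle i c \<longleftrightarrow> is_chain i c \<and> (\<forall>G. boundary c G = 0)"

definition subchain :: "('a set \<Rightarrow> 'g::zero) \<Rightarrow> ('a set \<Rightarrow> 'g) \<Rightarrow> bool" where
  "subchain c' c \<longleftrightarrow> (\<forall>F. c' F \<in> {0, c F})"

definition minimal_cycle :: "nat \<Rightarrow> ('a::linorder set \<Rightarrow> 'g::ab_group_add) \<Rightarrow> bool" where
  "minimal_cycle i c \<longleftrightarrow>
     is_cycle i c \<and>
     (\<forall>c'. subchain c' c \<and> is_cycle i c' \<longrightarrow> c' = c \<or> c' = (\<lambda>_. 0))"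

text \<open>The coefficient group is the type \<open>'g\<close>; it is passed as an argument since it cannot
  be inferred from the complex.\<close>

definition minimal_cycle_complex ::
    "'g::ab_group_add itself \<Rightarrow> nat \<Rightarrow> 'a::linorder set set \<Rightarrow> bool" where
  "minimal_cycle_complex _ i \<Delta> \<longleftrightarrow>
     simplicial_complex \<Delta> \<and> has_dimension \<Delta> i \<and>
     ((\<exists>F. finite F \<and> card F = i + 1 \<and> \<Delta> = generated {F}) \<or>
      (\<exists>c :: 'a set \<Rightarrow> 'g.
         c \<noteq> (\<lambda>_. 0) \<and> minimal_cycle i c \<and> \<Delta> = generated (supp c)))"


text \<open>Only the values of a coloring on the vertex set are relevant.\<close>

definition proper_coloring :: "nat \<Rightarrow> 'a set set \<Rightarrow> ('a \<Rightarrow> nat) \<Rightarrow> bool" where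
  "proper_coloring d \<Delta> \<kappa> \<longleftrightarrow>
     \<kappa> ` verts \<Delta> \<subseteq> {1..d} \<and> (\<forall>F\<in>\<Delta>. \<forall>i\<in>{1..d}. card {v \<in> F. \<kappa> v = i} \<le> 1)"

definition balanced :: "nat \<Rightarrow> 'a set set \<Rightarrow> bool" where
  "balanced d \<Delta> \<longleftrightarrow> has_dimension \<Delta> (d - 1) \<and> (\<exists>\<kappa>. proper_coloring d \<Delta> \<kappa>)"

definition rank_selected :: "'a set set \<Rightarrow> ('a \<Rightarrow> nat) \<Rightarrow> nat set \<Rightarrow> 'a set set" where
  "rank_selected \<Delta> \<kappa> T = induced \<Delta> {v \<in> verts \<Delta>. \<kappa> v \<in> T}"


definition finite_simple_graph :: "'a set \<times> 'a set set \<Rightarrow> bool" where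
  "finite_simple_graph G \<longleftrightarrow> finite (fst G) \<and> (\<forall>e\<in>snd G. e \<subseteq> fst G \<and> card e = 2)"

text \<open>Points of \<open>\<real>\<^sup>k\<close> are the elements of \<^term>\<open>carrier_vec k\<close>, since the dimension \<open>k\<close> is
  a term (the cardinality of a set of colors). Maps on the vertex set of a graph are total functions
  of which only the values on that set are used.\<close>

definition framework :: "nat \<Rightarrow> 'a set \<times> 'a set set \<Rightarrow> ('a \<Rightarrow> real vec) \<Rightarrow> bool" where
  "framework k G p \<longleftrightarrow> finite_simple_graph G \<and> (\<forall>v\<in>fst G. p v \<in> carrier_vec k)"

definition infinitesimal_motion ::
    "nat \<Rightarrow> 'a set \<times> 'a set set \<Rightarrow> ('a \<Rightarrow> real vec) \<Rightarrow> ('a \<Rightarrow> real vec) \<Rightarrow> bool" where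
  "infinitesimal_motion k G p q \<longleftrightarrow>
     (\<forall>v\<in>fst G. q v \<in> carrier_vec k) \<and>
     (\<forall>i j. {i, j} \<in> snd G \<longrightarrow> (p i - p j) \<bullet> (q i - q j) = 0)"

definition trivial_motion ::
    "nat \<Rightarrow> 'a set \<times> 'a set set \<Rightarrow> ('a \<Rightarrow> real vec) \<Rightarrow> ('a \<Rightarrow> real vec) \<Rightarrow> bool" where
  "trivial_motion k G p q \<longleftrightarrow>
     (\<exists>S \<in> carrier_mat k k. \<exists>t \<in> carrier_vec k.
        transpose_mat S = - S \<and> (\<forall>i\<in>fst G. q i = S *\<^sub>v p i + t))"

definition infinitesimally_rigid ::
    "nat \<Rightarrow> 'a set \<times> 'a set set \<Rightarrow> ('a \<Rightarrow> real vec) \<Rightarrow> bool" where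
  "infinitesimally_rigid k G p \<longleftrightarrow>
     (\<forall>q. infinitesimal_motion k G p q \<longrightarrow> trivial_motion k G p q)"

definition rigid :: "nat \<Rightarrow> 'a set \<times> 'a set set \<Rightarrow> bool" where
  "rigid k G \<longleftrightarrow> (\<exists>p. framework k G p \<and> infinitesimally_rigid k G p)"

end

theory Submission
  imports Defs "HOL-Computational_Algebra.Polynomial" "Jordan_Normal_Form.Determinant"
begin

text \<open>
Call two faces of size \<open>k\<close> linked if they lie in the vertex set of one generically rigid subgraph.
Rigid subgraphs sharing \<open>k\<close> pairwise adjacent vertices glue, so this is an equivalence
relation. Fogelsanger's theorem takes the following form: for a \<open>(k-1)\<close>-cycle \<open>c\<close>, \<open>k \<ge> 3\<close>,
the restriction of \<open>c\<close> to a linkage class is again a cycle. To see it, take \<open>c\<close> minimal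
(otherwise split it) and contract an edge \<open>uv\<close>. The lift to \<open>c\<close> of a class of the contracted
cycle is a proper nonzero subchain, hence not a cycle; its boundary is a suspension over \<open>{u, v}\<close> of
a nonzero cycle, which yields \<open>k - 1\<close> common neighbours of \<open>u\<close> and \<open>v\<close>, and vertex splitting
makes the lift rigid. A ridge in its boundary then forces all classes meeting there together.

For the rank selection, put two facets of the minimal cycle into the same class if their
\<open>T\<close>-colored parts are linked. Each class is a cycle: at a ridge missing a color outside \<open>T\<close> all
facets have the same \<open>T\<close>-colored part, and at a ridge missing a color of \<open>T\<close> Fogelsanger's
theorem applies to the link of its part colored outside \<open>T\<close>. By minimality there is one class.
\<close>

section \<open>Chains and edge contraction\<close>

text \<open>Contraction does not preserve minimality, and over a general group the contracted cycle
  may split into subcycles in many ways. Speaking of linkage classes avoids the choice of a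
  decomposition: the claim makes sense for every cycle and passes to subchains as long as the
  adjacency relation is kept, so one induction on the size of the support covers splitting and
  contraction. For this reason the relation is a parameter that only has to make every face a
  clique; in the rank selection the links of different faces then share one linkage relation. Faces
  have k vertices while the ambient space is R^k, although k points affinely span only a hyperplane:
  an infinitesimal isometry that vanishes on k linearly independent points is zero, so pinning one
  face removes all trivial motions. Rigidity is therefore expressed by pinned cliques, and gluing
  needs no more than k common vertices. Adjacency is reflexive on the vertices in play, since
  contraction turns the edge uv into a loop; a loop imposes no condition on a motion.\<close>

definition pm :: "nat \<Rightarrow> 'g::ab_group_add \<Rightarrow> 'g" where
  "pm n a = (if even n then a else - a)"

lemma pm_0 [simp]: "pm n 0 = 0"
  by (simp add: pm_def)

lemma pm_eq_0_iff [simp]: "pm n a = 0 \<longleftrightarrow> a = 0"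
  by (simp add: pm_def)

lemma pm_add: "pm n (a + b) = pm n a + pm n b"
  by (simp add: pm_def)

lemma pm_pm: "pm m (pm n a) = pm (m + n) a"
  by (auto simp: pm_def)

lemma pm_Suc: "pm (Suc n) a = - pm n a"
  by (auto simp: pm_def)

lemma pm_sum: "pm n (sum f A) = (\<Sum>x\<in>A. pm n (f x))"
  by (simp add: pm_def sum_negf)

lemma pm_cong_parity: "even (m + n) \<Longrightarrow> pm m a = pm n a"
  by (auto simp: pm_def)

text \<open>The sign \<open>(-1)\<^sup>j\<close> of the informal boundary operator is replaced by \<open>(-1)\<^sup>j\<^sup>-\<^sup>1\<close>.\<close>

definition bdry :: "'a::linorder set \<Rightarrow> ('a set \<Rightarrow> 'g::ab_group_add) \<Rightarrow> 'a set \<Rightarrow> 'g" where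
  "bdry V c R = (\<Sum>x\<in>V - R. pm (card {y\<in>R. y < x}) (c (insert x R)))"

definition restr :: "('b \<Rightarrow> 'g::zero) \<Rightarrow> 'b set \<Rightarrow> 'b \<Rightarrow> 'g" where
  "restr c A F = (if F \<in> A then c F else 0)"

lemma bdry_add: "bdry V (\<lambda>F. b F + c F) R = bdry V b R + bdry V c R"
  by (simp add: bdry_def pm_add sum.distrib)

text \<open>Adding \<open>x\<close> before \<open>y\<close> and adding \<open>y\<close> before
  \<open>x\<close> lead to the same coface with opposite signs, because only the smaller vertex
  shifts the position of the other. Later uses read the identity as: a nonzero term must be
  cancelled by another one.\<close>

lemma bdry_bdry:
  fixes c :: "'a::linorder set \<Rightarrow> 'g::ab_group_add"
  assumes V: "finite V" and R: "finite R"
  shows "bdry V (bdry V c) R = 0"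
proof -
  let ?n = "\<lambda>R x. card {y\<in>R. y < x}"
  define g where "g = (\<lambda>x y. pm (?n R x + ?n (insert x R) y) (c (insert y (insert x R))))"
  let ?U = "V - R"
  have anti: "g x y + g y x = 0" if "x \<in> ?U" "y \<in> ?U" "x < y" for x y
  proof -
    have 1: "{z\<in>insert x R. z < y} = insert x {z\<in>R. z < y}" using that by auto
    have 2: "{z\<in>insert y R. z < x} = {z\<in>R. z < x}" using that by auto
    have "?n (insert x R) y = Suc (?n R y)"
      unfolding 1 using that R by simp
    then show ?thesis
      unfolding g_def 2 by (simp add: pm_Suc insert_commute add.commute)
  qed
  have inn: "pm (?n R x) (bdry V c (insert x R)) = (\<Sum>y\<in>?U. if y = x then 0 else g x y)" if "x \<in> ?U" for x
  proof -
    have "pm (?n R x) (bdry V c (insert x R)) = (\<Sum>y\<in>V - insert x R. g x y)"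
      by (simp add: bdry_def pm_sum g_def pm_pm)
    also have "\<dots> = (\<Sum>y\<in>?U. if y = x then 0 else g x y)"
      using V by (intro sum.mono_neutral_cong_left) auto
    finally show ?thesis .
  qed
  have "bdry V (bdry V c) R = (\<Sum>x\<in>?U. \<Sum>y\<in>?U. if y = x then 0 else g x y)"
    by (subst bdry_def) (use inn in simp)
  also have "\<dots> = (\<Sum>x\<in>?U. \<Sum>y\<in>?U. (if x < y then g x y else 0) + (if y < x then g x y else 0))"
    by (intro sum.cong refl) auto
  also have "\<dots> = (\<Sum>x\<in>?U. \<Sum>y\<in>?U. if x < y then g x y else 0)
                + (\<Sum>x\<in>?U. \<Sum>y\<in>?U. if y < x then g x y else 0)"
    by (simp add: sum.distrib)
  also have "(\<Sum>x\<in>?U. \<Sum>y\<in>?U. if y < x then g x y else 0)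
           = (\<Sum>x\<in>?U. \<Sum>y\<in>?U. if x < y then g y x else 0)"
    by (rule sum.swap)
  also have "(\<Sum>x\<in>?U. \<Sum>y\<in>?U. if x < y then g x y else 0) + \<dots>
           = (\<Sum>x\<in>?U. \<Sum>y\<in>?U. if x < y then g x y + g y x else 0)"
    by (simp add: sum.distrib[symmetric] cong: if_cong) (intro sum.cong refl, auto)
  also have "\<dots> = 0"
    using anti by (intro sum.neutral ballI) auto
  finally show ?thesis .
qed

text \<open>The push-forward of \<open>c\<close> along the vertex map sending \<open>v\<close> to
  \<open>u\<close>, for \<open>u < v\<close>. Faces containing both degenerate; in the others
  \<open>v\<close> passes the vertices strictly between on its way to the position of
  \<open>u\<close>, whence the sign.\<close>

definition contract :: "'a::linorder \<Rightarrow> 'a \<Rightarrow> ('a set \<Rightarrow> 'g::ab_group_add) \<Rightarrow> 'a set \<Rightarrow> 'g" where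
  "contract u v c B = (if v \<in> B then 0
     else if u \<in> B then c B + pm (card {y\<in>B. u < y \<and> y < v}) (c (insert v (B - {u})))
     else c B)"

lemma card_less_split:
  fixes u v :: "'a::linorder"
  assumes "finite R" "u < v" "u \<notin> R"
  shows "card {y\<in>R. y < v} = card {y\<in>R. y < u} + card {y\<in>R. u < y \<and> y < v}"
proof -
  have "{y\<in>R. y < v} = {y\<in>R. y < u} \<union> {y\<in>R. u < y \<and> y < v}"
    using assms by (auto simp: not_less order_le_less)
  then show ?thesis
    using assms(1) by (simp add: card_Un_disjoint disjoint_iff order_less_imp_not_less)
qed

text \<open>The coface \<open>insert v R\<close> disappears, but its coefficient is passed on to
  \<open>insert u R\<close>, and the sign in \<open>contract\<close> is the difference of the two
  positions relative to \<open>R\<close>. With the next two lemmas this makes contraction a chain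
  map.\<close>

lemma bdry_contract_off:
  fixes c :: "'a::linorder set \<Rightarrow> 'g::ab_group_add"
  assumes V: "finite V" "u \<in> V" "v \<in> V" and R: "finite R" and uv: "u < v" "u \<notin> R" "v \<notin> R"
  shows "bdry V (contract u v c) R = bdry V c R"
proof -
  have VR: "V - R = insert u (insert v (V - R - {u,v}))" using assms by auto
  let ?n = "\<lambda>x. card {y\<in>R. y < x}"
  have split: "bdry V f R = pm (?n u) (f (insert u R)) + (pm (?n v) (f (insert v R))
      + (\<Sum>x\<in>V - R - {u,v}. pm (?n x) (f (insert x R))))" for f :: "'a set \<Rightarrow> 'g"
    unfolding bdry_def by (subst VR) (use V uv in simp)
  have 1: "(\<Sum>x\<in>V - R - {u,v}. pm (?n x) (contract u v c (insert x R)))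
      = (\<Sum>x\<in>V - R - {u,v}. pm (?n x) (c (insert x R)))"
    using uv by (intro sum.cong) (auto simp: contract_def)
  have "{y \<in> insert u R. u < y \<and> y < v} = {y\<in>R. u < y \<and> y < v}" by auto
  moreover have "insert u R - {u} = R" using uv by auto
  ultimately have 2: "contract u v c (insert u R)
      = c (insert u R) + pm (card {y\<in>R. u < y \<and> y < v}) (c (insert v R))"
    using uv by (auto simp: contract_def)
  have 3: "contract u v c (insert v R) = 0" by (simp add: contract_def)
  show ?thesis
    unfolding split 1 2 3 card_less_split[OF R uv(1,2)] by (simp add: pm_add pm_pm add.assoc)
qed

text \<open>The coface \<open>insert u (insert v G)\<close> is sent to zero on the left and occurs
  twice with opposite signs on the right. For any other new vertex \<open>x\<close> the signs agree,
  because an even number of the relations \<open>u < x\<close>, \<open>u < x < v\<close>,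
  \<open>v < x\<close> hold.\<close>

lemma bdry_contract_on:
  fixes c :: "'a::linorder set \<Rightarrow> 'g::ab_group_add"
  assumes V: "finite V" "u \<in> V" "v \<in> V" and G: "finite G" and uv: "u < v" "u \<notin> G" "v \<notin> G"
  shows "bdry V (contract u v c) (insert u G)
       = bdry V c (insert u G) + pm (card {y\<in>G. u < y \<and> y < v}) (bdry V c (insert v G))"
proof -
  let ?n = "\<lambda>R x. card {y\<in>R. y < x}"
  let ?h = "\<lambda>G. card {y\<in>G. u < y \<and> y < v}"
  let ?W = "V - G - {u,v}"
  have Vu: "V - insert u G = insert v ?W" and Vv: "V - insert v G = insert u ?W"
    using assms by auto
  have spu: "bdry V f (insert u G) = pm (?n (insert u G) v) (f (insert v (insert u G)))
      + (\<Sum>x\<in>?W. pm (?n (insert u G) x) (f (insert x (insert u G))))" for f :: "'a set \<Rightarrow> 'g"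
    unfolding bdry_def by (subst Vu) (use V in simp)
  have spv: "bdry V f (insert v G) = pm (?n (insert v G) u) (f (insert u (insert v G)))
      + (\<Sum>x\<in>?W. pm (?n (insert v G) x) (f (insert x (insert v G))))" for f :: "'a set \<Rightarrow> 'g"
    unfolding bdry_def by (subst Vv) (use V in simp)
  have "{y\<in>insert u G. y < v} = insert u {y\<in>G. y < v}" using uv by auto
  then have nu: "?n (insert u G) v = Suc (?n G u + ?h G)"
    using G uv card_less_split[OF G uv(1,2)] by simp
  have "{y\<in>insert v G. y < u} = {y\<in>G. y < u}" using uv by auto
  then have nv: "?n (insert v G) u = ?n G u" by simp
  have summand: "pm (?n (insert u G) x) (contract u v c (insert x (insert u G)))
     = pm (?n (insert u G) x) (c (insert x (insert u G)))
       + pm (?h G) (pm (?n (insert v G) x) (c (insert x (insert v G))))" if x: "x \<in> ?W" for x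
  proof -
    have "insert x (insert u G) - {u} = insert x G" using x uv by auto
    then have ct: "contract u v c (insert x (insert u G)) = c (insert x (insert u G))
        + pm (?h (insert x (insert u G))) (c (insert x (insert v G)))"
      using x uv by (auto simp: contract_def insert_commute)
    have a: "?n (insert u G) x = ?n G x + (if u < x then 1 else 0)"
    proof -
      have "{y\<in>insert u G. y < x} = (if u < x then insert u {y\<in>G. y < x} else {y\<in>G. y < x})" by auto
      then show ?thesis using G uv by auto
    qed
    have b: "?n (insert v G) x = ?n G x + (if v < x then 1 else 0)"
    proof -
      have "{y\<in>insert v G. y < x} = (if v < x then insert v {y\<in>G. y < x} else {y\<in>G. y < x})" by auto
      then show ?thesis using G uv by auto
    qed
    have e: "?h (insert x (insert u G)) = ?h G + (if u < x \<and> x < v then 1 else 0)"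
    proof -
      have "{y\<in>insert x (insert u G). u < y \<and> y < v}
          = (if u < x \<and> x < v then insert x {y\<in>G. u < y \<and> y < v} else {y\<in>G. u < y \<and> y < v})" by auto
      then show ?thesis using G x by auto
    qed
    have "even ((?n (insert u G) x + ?h (insert x (insert u G))) + (?h G + ?n (insert v G) x))"
      unfolding a b e using x uv by auto
    then have "pm (?n (insert u G) x + ?h (insert x (insert u G))) (c (insert x (insert v G)))
        = pm (?h G + ?n (insert v G) x) (c (insert x (insert v G)))"
      by (rule pm_cong_parity)
    then show ?thesis
      unfolding ct pm_add pm_pm by simp
  qed
  have z: "contract u v c (insert v (insert u G)) = 0" by (simp add: contract_def)
  show ?thesis
    unfolding spu[of "contract u v c"] z
    unfolding spu[of c] spv[of c] nu nv
    using summand by (simp add: sum.distrib pm_add pm_pm pm_sum pm_Suc insert_commute[of u v] add.commute)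
qed

lemma bdry_contract_snd: "v \<in> R \<Longrightarrow> bdry V (contract u v c) R = 0"
  by (simp add: bdry_def contract_def)

section \<open>Generic configurations\<close>

definition trivial_kernel :: "'j set \<Rightarrow> 'i set \<Rightarrow> ('j \<Rightarrow> 'i \<Rightarrow> real) \<Rightarrow> bool" where
  "trivial_kernel J I L \<longleftrightarrow>
     (\<forall>q. (\<forall>j\<in>J. (\<Sum>i\<in>I. L j i * q i) = 0) \<longrightarrow> (\<forall>i\<in>I. q i = 0))"

text \<open>Abstract because elimination is applied to functions of a whole configuration and again
  to functions of a single perturbation parameter.\<close>

definition function_algebra :: "(('p \<Rightarrow> real) \<Rightarrow> bool) \<Rightarrow> bool" where
  "function_algebra \<A> \<longleftrightarrow> (\<forall>a. \<A> (\<lambda>_. a)) \<and>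
     (\<forall>f g. \<A> f \<longrightarrow> \<A> g \<longrightarrow> \<A> (\<lambda>p. f p * g p) \<and> \<A> (\<lambda>p. f p - g p))"

text \<open>Gaussian elimination without divisions: the product of the pivots is an element of the
  algebra \<open>\<A>\<close> of functions whose non-vanishing preserves the trivial kernel.\<close>

lemma trivial_kernel_open:
  fixes L :: "'p \<Rightarrow> 'j \<Rightarrow> 'i \<Rightarrow> real" and \<A> :: "('p \<Rightarrow> real) \<Rightarrow> bool"
  assumes "finite I"
    and alg: "function_algebra \<A>"
    and "\<And>j i. j \<in> J \<Longrightarrow> i \<in> I \<Longrightarrow> \<A> (\<lambda>p. L p j i)"
    and "trivial_kernel J I (L p0)"
  shows "\<exists>f. \<A> f \<and> f p0 \<noteq> 0 \<and> (\<forall>p. f p \<noteq> 0 \<longrightarrow> trivial_kernel J I (L p))"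
  using assms(1,3,4)
proof (induction I arbitrary: L rule: finite_induct)
  case empty
  show ?case using alg unfolding function_algebra_def by (intro exI[of _ "\<lambda>_. 1"]) (auto simp: trivial_kernel_def)
next
  case (insert i I)
  have sum_ins: "(\<Sum>i'\<in>insert i I. L p j i' * q i') = L p j i * q i + (\<Sum>i'\<in>I. L p j i' * q i')" for p j q
    using insert by simp
  have "\<exists>j\<in>J. L p0 j i \<noteq> 0"
  proof (rule ccontr)
    assume "\<not> ?thesis"
    then have z: "L p0 j i = 0" if "j \<in> J" for j using that by blast
    let ?q = "\<lambda>i'. if i' = i then 1 else 0 :: real"
    have "(\<Sum>i'\<in>I. L p0 j i' * ?q i') = 0" for j
      using insert(2) by (intro sum.neutral) auto
    then have "\<forall>j\<in>J. (\<Sum>i'\<in>insert i I. L p0 j i' * ?q i') = 0"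
      using z by (simp only: sum_ins) simp
    then have "?q i = 0"
      using insert.prems(2)[unfolded trivial_kernel_def, rule_format, of ?q i] by blast
    then show False by simp
  qed
  then obtain j where j: "j \<in> J" "L p0 j i \<noteq> 0" by blast
  have mult: "\<A> (\<lambda>p. f p * g p)" and diff: "\<A> (\<lambda>p. f p - g p)" if "\<A> f" "\<A> g" for f g
    using alg that unfolding function_algebra_def by blast+
  \<comment> \<open>Cross-multiplication with the pivot row \<open>j\<close> cancels column
    \<open>i\<close> and keeps the entries in \<open>\<A>\<close>.\<close>
  define L' where "L' = (\<lambda>p j' i'. L p j i * L p j' i' - L p j' i * L p j i')"
  have sumL': "(\<Sum>i'\<in>I. L' p j' i' * q i')
      = L p j i * (\<Sum>i'\<in>I. L p j' i' * q i') - L p j' i * (\<Sum>i'\<in>I. L p j i' * q i')" for p j' q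
    by (simp add: L'_def sum_distrib_left sum_subtractf algebra_simps)
  have "trivial_kernel J I (L' p0)"
    unfolding trivial_kernel_def
  proof (intro allI impI)
    fix q assume q: "\<forall>j'\<in>J. (\<Sum>i'\<in>I. L' p0 j' i' * q i') = 0"
    \<comment> \<open>At \<open>p0\<close> the pivot row determines the missing unknown; the
      division is by a number, not by a function.\<close>
    define q' where "q' = q(i := - (\<Sum>i'\<in>I. L p0 j i' * q i') / L p0 j i)"
    have qI: "(\<Sum>i'\<in>I. L p0 j' i' * q' i') = (\<Sum>i'\<in>I. L p0 j' i' * q i')" for j'
      using insert(2) by (intro sum.cong) (auto simp: q'_def)
    have "(\<Sum>i'\<in>insert i I. L p0 j' i' * q' i') = 0" if "j' \<in> J" for j'
    proof -
      have "L p0 j i * (\<Sum>i'\<in>insert i I. L p0 j' i' * q' i') = (\<Sum>i'\<in>I. L' p0 j' i' * q i')"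
        using j unfolding sum_ins qI sumL' by (simp add: q'_def field_simps)
      then show ?thesis using q that j by simp
    qed
    then have "\<forall>i'\<in>insert i I. q' i' = 0"
      using insert.prems(2) unfolding trivial_kernel_def by blast
    then show "\<forall>i'\<in>I. q i' = 0" using insert(2) by (auto simp: q'_def split: if_splits)
  qed
  moreover have "\<A> (\<lambda>p. L' p j' i')" if "j' \<in> J" "i' \<in> I" for j' i'
    unfolding L'_def using that j(1) insert.prems(1) by (intro diff[OF mult mult]) auto
  ultimately obtain f where f: "\<A> f" "f p0 \<noteq> 0" "\<And>p. f p \<noteq> 0 \<Longrightarrow> trivial_kernel J I (L' p)"
    using insert.IH[of L'] by blast
  show ?case
  proof (intro exI[of _ "\<lambda>p. f p * L p j i"] conjI allI impI)
    show "\<A> (\<lambda>p. f p * L p j i)" by (rule mult[OF f(1) insert.prems(1)[OF j(1) insertI1]])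
    show "f p0 * L p0 j i \<noteq> 0" using f j by auto
    fix p assume p: "f p * L p j i \<noteq> 0"
    show "trivial_kernel J (insert i I) (L p)"
      unfolding trivial_kernel_def
    proof (intro allI impI)
      fix q assume q: "\<forall>j'\<in>J. (\<Sum>i'\<in>insert i I. L p j' i' * q i') = 0"
      have "(\<Sum>i'\<in>I. L' p j' i' * q i') = 0" if "j' \<in> J" for j'
      proof -
        have "(\<Sum>i'\<in>I. L p j' i' * q i') = - (L p j' i * q i)" if "j' \<in> J" for j'
          using q that unfolding sum_ins by (simp add: eq_neg_iff_add_eq_0 add.commute)
        then show ?thesis using that j(1) unfolding sumL' by simp
      qed
      then have qI: "\<forall>i'\<in>I. q i' = 0"
        using f(3)[of p] p unfolding trivial_kernel_def by auto
      then have "L p j i * q i = 0"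
        using bspec[OF q j(1)] unfolding sum_ins by simp
      then show "\<forall>i'\<in>insert i I. q i' = 0" using p qI by auto
    qed
  qed
qed

section \<open>Functions that are polynomial along lines, and generic properties\<close>

definition line_polynomial :: "(('a \<Rightarrow> nat \<Rightarrow> real) \<Rightarrow> real) \<Rightarrow> bool" where
  "line_polynomial f \<longleftrightarrow> (\<forall>p q. \<exists>r. \<forall>t. f (\<lambda>x i. p x i + t * q x i) = poly r t)"

lemma line_polynomial_const: "line_polynomial (\<lambda>_. a)"
  unfolding line_polynomial_def by (intro allI exI[of _ "[:a:]"]) simp

lemma line_polynomial_coord: "line_polynomial (\<lambda>p. p x i)"
  unfolding line_polynomial_def
proof (intro allI)
  fix p q :: "'a \<Rightarrow> nat \<Rightarrow> real"
  show "\<exists>r. \<forall>t. p x i + t * q x i = poly r t"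
    by (intro exI[of _ "[:p x i, q x i:]"]) simp
qed

lemma line_polynomial_mult:
  "line_polynomial f \<Longrightarrow> line_polynomial g \<Longrightarrow> line_polynomial (\<lambda>p. f p * g p)"
proof -
  assume fg: "line_polynomial f" "line_polynomial g"
  show ?thesis
    unfolding line_polynomial_def
  proof (intro allI)
    fix p q :: "'a \<Rightarrow> nat \<Rightarrow> real"
    obtain r s where "\<forall>t. f (\<lambda>x i. p x i + t * q x i) = poly r t"
      and "\<forall>t. g (\<lambda>x i. p x i + t * q x i) = poly s t"
      using fg unfolding line_polynomial_def by blast
    then have "\<forall>t. f (\<lambda>x i. p x i + t * q x i) * g (\<lambda>x i. p x i + t * q x i) = poly (r * s) t"
      by simp
    then show "\<exists>r. \<forall>t. f (\<lambda>x i. p x i + t * q x i) * g (\<lambda>x i. p x i + t * q x i) = poly r t"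
      by blast
  qed
qed

lemma line_polynomial_diff:
  "line_polynomial f \<Longrightarrow> line_polynomial g \<Longrightarrow> line_polynomial (\<lambda>p. f p - g p)"
proof -
  assume fg: "line_polynomial f" "line_polynomial g"
  show ?thesis
    unfolding line_polynomial_def
  proof (intro allI)
    fix p q :: "'a \<Rightarrow> nat \<Rightarrow> real"
    obtain r s where "\<forall>t. f (\<lambda>x i. p x i + t * q x i) = poly r t"
      and "\<forall>t. g (\<lambda>x i. p x i + t * q x i) = poly s t"
      using fg unfolding line_polynomial_def by blast
    then have "\<forall>t. f (\<lambda>x i. p x i + t * q x i) - g (\<lambda>x i. p x i + t * q x i) = poly (r - s) t"
      by simp
    then show "\<exists>r. \<forall>t. f (\<lambda>x i. p x i + t * q x i) - g (\<lambda>x i. p x i + t * q x i) = poly r t"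
      by blast
  qed
qed

lemma line_polynomial_algebra: "function_algebra line_polynomial"
  unfolding function_algebra_def
  using line_polynomial_const line_polynomial_mult line_polynomial_diff by blast

text \<open>A substitute for non-empty Zariski open sets of configurations that needs no multivariate
  polynomials.\<close>

definition generic :: "(('a \<Rightarrow> nat \<Rightarrow> real) \<Rightarrow> bool) \<Rightarrow> bool" where
  "generic P \<longleftrightarrow> (\<exists>f. line_polynomial f \<and> (\<exists>p. f p \<noteq> 0) \<and> (\<forall>p. f p \<noteq> 0 \<longrightarrow> P p))"

lemma generic_ex: "generic P \<Longrightarrow> \<exists>p. P p"
  unfolding generic_def by blast

lemma generic_True: "generic (\<lambda>_. True)"
  unfolding generic_def by (intro exI[of _ "\<lambda>_. 1"]) (simp add: line_polynomial_const)

lemma generic_mono: "generic P \<Longrightarrow> (\<And>p. P p \<Longrightarrow> Q p) \<Longrightarrow> generic Q"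
  unfolding generic_def by blast

text \<open>On the line joining a witness of \<open>P\<close> to a witness of \<open>Q\<close> both
  test functions are nonzero univariate polynomials, so their product is nonzero at some
  parameter.\<close>

lemma generic_conj:
  assumes "generic P" "generic Q"
  shows "generic (\<lambda>p. P p \<and> Q p)"
proof -
  from assms obtain f g p q where f: "line_polynomial f" "f p \<noteq> 0" "\<And>p. f p \<noteq> 0 \<Longrightarrow> P p"
    and g: "line_polynomial g" "g q \<noteq> 0" "\<And>p. g p \<noteq> 0 \<Longrightarrow> Q p"
    unfolding generic_def by blast
  define e where "e = (\<lambda>x i. q x i - p x i)"
  define line where "line = (\<lambda>t x i. p x i + t * e x i)"
  obtain r where r: "\<And>t. f (line t) = poly r t"
    using f(1)[unfolded line_polynomial_def, rule_format, of p e] unfolding line_def by blast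
  obtain s where s: "\<And>t. g (line t) = poly s t"
    using g(1)[unfolded line_polynomial_def, rule_format, of p e] unfolding line_def by blast
  have "line 0 = p" "line 1 = q" by (auto simp: line_def e_def)
  then have "r \<noteq> 0" "s \<noteq> 0" using r[of 0] s[of 1] f(2) g(2) by auto
  then have "\<exists>t. poly (r * s) t \<noteq> 0" using poly_all_0_iff_0 no_zero_divisors by blast
  then obtain t where "f (line t) * g (line t) \<noteq> 0" using r s by auto
  then show ?thesis
    unfolding generic_def using f(3) g(3) line_polynomial_mult[OF f(1) g(1)]
    by (intro exI[of _ "\<lambda>p. f p * g p"]) auto
qed

text \<open>The points of a configuration span \<open>\<real>\<^sup>k\<close> iff no nonzero vector is orthogonal to all of
  them.\<close>

definition spanning :: "nat \<Rightarrow> 'a set \<Rightarrow> ('a \<Rightarrow> nat \<Rightarrow> real) \<Rightarrow> bool" where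
  "spanning k F p \<longleftrightarrow> (\<forall>y. (\<forall>x\<in>F. (\<Sum>i<k. p x i * y i) = 0) \<longrightarrow> (\<forall>i<k. y i = 0))"

lemma generic_spanning:
  assumes "card F = k" "k > 0"
  shows "generic (spanning k F)"
proof -
  have fin: "finite F" using assms card_ge_0_finite by blast
  then obtain h where h: "bij_betw h {..<k} F"
    using assms(1) ex_bij_betw_nat_finite[of F] by (auto simp: lessThan_atLeast0)
  \<comment> \<open>The points of \<open>F\<close> are placed at the standard basis vectors.\<close>
  define p0 where "p0 = (\<lambda>x i. if x = h i then 1 else 0 :: real)"
  have sp: "spanning k F p = trivial_kernel F {..<k} p" for p
    unfolding spanning_def trivial_kernel_def by (simp only: lessThan_iff Ball_def)
  have "trivial_kernel F {..<k} p0"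
    unfolding trivial_kernel_def
  proof (intro allI impI ballI)
    fix y :: "nat \<Rightarrow> real" and i assume y: "\<forall>x\<in>F. (\<Sum>i\<in>{..<k}. p0 x i * y i) = 0" and i: "i \<in> {..<k}"
    have "(\<Sum>j\<in>{..<k}. p0 (h i) j * y j) = (\<Sum>j\<in>{..<k}. if j = i then y j else 0)"
      using h i by (intro sum.cong) (auto simp: p0_def bij_betw_def inj_on_def)
    moreover have "h i \<in> F" using h i by (auto simp: bij_betw_def)
    ultimately show "y i = 0" using y i by auto
  qed
  note trivial_kernel_open[of "{..<k}" line_polynomial F "\<lambda>p. p" p0,
      OF finite_lessThan line_polynomial_algebra line_polynomial_coord this]
  then show ?thesis unfolding generic_def sp by blast
qed

text \<open>Directions \<open>\<delta> x y\<close> independent of a configuration allow edges of length zero.\<close>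

definition locked_dir :: "nat \<Rightarrow> ('a \<Rightarrow> 'a \<Rightarrow> bool) \<Rightarrow> 'a set \<Rightarrow> 'a set \<Rightarrow> ('a \<Rightarrow> 'a \<Rightarrow> nat \<Rightarrow> real) \<Rightarrow> bool" where
  "locked_dir k E X F \<delta> \<longleftrightarrow>
     (\<forall>q. (\<forall>x\<in>X. \<forall>y\<in>X. E x y \<longrightarrow> (\<Sum>i<k. \<delta> x y i * (q x i - q y i)) = 0) \<and>
          (\<forall>x\<in>F. \<forall>i<k. q x i = 0) \<longrightarrow> (\<forall>x\<in>X. \<forall>i<k. q x i = 0))"

abbreviation locked :: "nat \<Rightarrow> ('a \<Rightarrow> 'a \<Rightarrow> bool) \<Rightarrow> 'a set \<Rightarrow> 'a set \<Rightarrow> ('a \<Rightarrow> nat \<Rightarrow> real) \<Rightarrow> bool" where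
  "locked k E X F p \<equiv> locked_dir k E X F (\<lambda>x y i. p x i - p y i)"

text \<open>Being locked means that a rigidity matrix, enlarged by a unit row for each pinned
  coordinate, has trivial kernel. The unknowns are all coordinates of all velocities, so the
  elimination lemma applies.\<close>

lemma locked_dir_open:
  fixes \<delta> :: "'p \<Rightarrow> 'a \<Rightarrow> 'a \<Rightarrow> nat \<Rightarrow> real" and \<A> :: "('p \<Rightarrow> real) \<Rightarrow> bool"
  assumes X: "finite X" and F: "F \<subseteq> X"
    and alg: "function_algebra \<A>"
    and dir: "\<And>x y i. \<A> (\<lambda>p. \<delta> p x y i)"
    and p0: "locked_dir k E X F (\<delta> p0)"
  shows "\<exists>f. \<A> f \<and> f p0 \<noteq> 0 \<and> (\<forall>p. f p \<noteq> 0 \<longrightarrow> locked_dir k E X F (\<delta> p))"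
proof -
  define I where "I = X \<times> {..<k}"
  define J :: "('a \<times> 'a + 'a \<times> nat) set" where
    "J = Inl ` {(x, y). x \<in> X \<and> y \<in> X \<and> E x y} \<union> Inr ` (F \<times> {..<k})"
  define L :: "'p \<Rightarrow> ('a \<times> 'a + 'a \<times> nat) \<Rightarrow> ('a \<times> nat) \<Rightarrow> real" where
    "L = (\<lambda>p j zi. case j of
        Inl xy \<Rightarrow> \<delta> p (fst xy) (snd xy) (snd zi) * (of_bool (fst zi = fst xy) - of_bool (fst zi = snd xy))
      | Inr xm \<Rightarrow> of_bool (zi = xm))"
  have pick: "(\<Sum>z\<in>X. a * of_bool (z = x) * q z) = a * q x" if "x \<in> X" for a x and q :: "'a \<Rightarrow> real"
    using X that by (simp add: of_bool_def if_distrib if_distribR cong: if_cong)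
  have edge: "(\<Sum>zi\<in>I. L p (Inl (x, y)) zi * q zi) = (\<Sum>i<k. \<delta> p x y i * (q (x, i) - q (y, i)))"
    if "x \<in> X" "y \<in> X" for p x y q
  proof -
    have "(\<Sum>zi\<in>I. L p (Inl (x, y)) zi * q zi) = (\<Sum>z\<in>X. \<Sum>i<k. L p (Inl (x, y)) (z, i) * q (z, i))"
      unfolding I_def by (simp add: sum.cartesian_product)
    also have "\<dots> = (\<Sum>i<k. \<Sum>z\<in>X. L p (Inl (x, y)) (z, i) * q (z, i))"
      by (rule sum.swap)
    also have "\<dots> = (\<Sum>i<k. \<delta> p x y i * (q (x, i) - q (y, i)))"
    proof (intro sum.cong refl)
      fix i
      have "(\<Sum>z\<in>X. L p (Inl (x, y)) (z, i) * q (z, i))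
          = (\<Sum>z\<in>X. \<delta> p x y i * of_bool (z = x) * q (z, i)) - (\<Sum>z\<in>X. \<delta> p x y i * of_bool (z = y) * q (z, i))"
        by (simp add: L_def sum_subtractf[symmetric] algebra_simps)
      then show "(\<Sum>z\<in>X. L p (Inl (x, y)) (z, i) * q (z, i)) = \<delta> p x y i * (q (x, i) - q (y, i))"
        unfolding pick[OF that(1), of _ "\<lambda>z. q (z, i)"] pick[OF that(2), of _ "\<lambda>z. q (z, i)"]
        by (simp only: right_diff_distrib)
    qed
    finally show ?thesis .
  qed
  have pin: "(\<Sum>zi\<in>I. L p (Inr (x, i)) zi * q zi) = q (x, i)" if "x \<in> F" "i < k" for p x i q
  proof -
    have "(\<Sum>zi\<in>I. L p (Inr (x, i)) zi * q zi) = (\<Sum>zi\<in>I. if zi = (x, i) then q zi else 0)"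
      by (intro sum.cong) (auto simp: L_def)
    also have "\<dots> = q (x, i)" using that F X by (auto simp: I_def)
    finally show ?thesis .
  qed
  have iff: "trivial_kernel J I (L p) \<longleftrightarrow> locked_dir k E X F (\<delta> p)" for p
  proof -
    have kern: "(\<forall>j\<in>J. (\<Sum>zi\<in>I. L p j zi * q zi) = 0) \<longleftrightarrow>
      (\<forall>x\<in>X. \<forall>y\<in>X. E x y \<longrightarrow> (\<Sum>i<k. \<delta> p x y i * (q (x, i) - q (y, i))) = 0) \<and>
          (\<forall>x\<in>F. \<forall>i<k. q (x, i) = 0)" for q
      unfolding J_def using edge pin by (auto simp: ball_Un)
    show ?thesis
    proof
      assume t: "trivial_kernel J I (L p)"
      show "locked_dir k E X F (\<delta> p)"
        unfolding locked_dir_def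
      proof (intro allI impI)
        fix q assume "(\<forall>x\<in>X. \<forall>y\<in>X. E x y \<longrightarrow> (\<Sum>i<k. \<delta> p x y i * (q x i - q y i)) = 0) \<and>
          (\<forall>x\<in>F. \<forall>i<k. q x i = 0)"
        then show "\<forall>x\<in>X. \<forall>i<k. q x i = 0"
          using t[unfolded trivial_kernel_def kern, rule_format, of "\<lambda>(x, i). q x i"] by (auto simp: I_def)
      qed
    next
      assume t: "locked_dir k E X F (\<delta> p)"
      show "trivial_kernel J I (L p)"
        unfolding trivial_kernel_def kern
      proof (intro allI impI)
        fix q assume "(\<forall>x\<in>X. \<forall>y\<in>X. E x y \<longrightarrow> (\<Sum>i<k. \<delta> p x y i * (q (x, i) - q (y, i))) = 0) \<and>
          (\<forall>x\<in>F. \<forall>i<k. q (x, i) = 0)"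
        then show "\<forall>zi\<in>I. q zi = 0"
          using t[unfolded locked_dir_def, rule_format, of "\<lambda>x i. q (x, i)"] by (auto simp: I_def)
      qed
    qed
  qed
  have A: "\<A> (\<lambda>p. L p j zi)" for j zi
  proof (cases j)
    case (Inl xy)
    have const: "\<A> (\<lambda>_. of_bool (fst zi = fst xy) - of_bool (fst zi = snd xy))"
      using alg unfolding function_algebra_def by blast
    have "\<A> (\<lambda>p. \<delta> p (fst xy) (snd xy) (snd zi) * (of_bool (fst zi = fst xy) - of_bool (fst zi = snd xy)))"
      using alg dir[of "fst xy" "snd xy" "snd zi"] const unfolding function_algebra_def by blast
    then show ?thesis by (simp only: Inl L_def sum.case)
  next
    case (Inr xm)
    have "\<A> (\<lambda>_. of_bool (zi = xm))" using alg unfolding function_algebra_def by blast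
    then show ?thesis by (simp only: Inr L_def sum.case)
  qed
  have I: "finite I" using X by (simp add: I_def)
  have "trivial_kernel J I (L p0)" by (simp only: iff p0)
  note trivial_kernel_open[of I \<A> J L p0, OF I alg A this]
  then show ?thesis unfolding iff .
qed

text \<open>Allows rigidity to be checked at one convenient configuration, as vertex splitting
  does.\<close>

lemma generic_locked:
  assumes "finite X" "F \<subseteq> X" "locked k E X F p0"
  shows "generic (locked k E X F)"
proof -
  have "line_polynomial (\<lambda>p. p x i - p y i)" for x y :: 'a and i
    by (rule line_polynomial_diff[OF line_polynomial_coord line_polynomial_coord])
  note locked_dir_open[of X F line_polynomial "\<lambda>p x y i. p x i - p y i" k E p0,
      OF assms(1,2) line_polynomial_algebra this assms(3)]
  then show ?thesis unfolding generic_def by blast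
qed

section \<open>Rigid vertex sets\<close>

text \<open>The vectors \<open>d y\<close> are the columns of the inverse of the matrix with rows
  \<open>p x\<close>. The right inverse identity evaluates them on \<open>F\<close>, the left
  inverse identity expands arbitrary vectors in them.\<close>

lemma dual_basis:
  assumes F: "card F = k" "finite F" and sp: "spanning k F p"
  obtains d :: "'a \<Rightarrow> nat \<Rightarrow> real" where
    "\<And>x y. x \<in> F \<Longrightarrow> y \<in> F \<Longrightarrow> (\<Sum>i<k. p x i * d y i) = of_bool (x = y)"
    "\<And>i j. i < k \<Longrightarrow> j < k \<Longrightarrow> (\<Sum>x\<in>F. d x i * p x j) = of_bool (i = j)"
proof -
  obtain h where h: "bij_betw h {..<k} F"
    using F ex_bij_betw_nat_finite[of F] by (auto simp: lessThan_atLeast0)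
  define g where "g = the_inv_into {..<k} h"
  have hF: "h a \<in> F" if "a < k" for a using h that by (auto simp: bij_betw_def)
  have g: "g x < k" "h (g x) = x" if "x \<in> F" for x
    using h that the_inv_into_into[of h "{..<k}" x "{..<k}"] f_the_inv_into_f[of h "{..<k}" x]
    by (auto simp: g_def bij_betw_def)
  have gh: "g (h a) = a" if "a < k" for a
    using h that by (simp add: g_def bij_betw_def the_inv_into_f_f)
  have inj_g: "inj_on g F" using g(2) by (rule inj_on_inverseI)
  define P where "P = mat k k (\<lambda>(a, i). p (h a) i)"
  have P: "P \<in> carrier_mat k k" by (simp add: P_def)
  have "det P \<noteq> 0"
  proof
    assume "det P = 0"
    then obtain v where v: "v \<in> carrier_vec k" "v \<noteq> 0\<^sub>v k" "P *\<^sub>v v = 0\<^sub>v k"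
      using det_0_iff_vec_prod_zero[OF P] by blast
    have "(\<Sum>i<k. p x i * v $ i) = 0" if "x \<in> F" for x
    proof -
      have "(P *\<^sub>v v) $ g x = 0" using v(3) g that by simp
      then show ?thesis
        using g that v(1) by (simp add: P_def scalar_prod_def lessThan_atLeast0)
    qed
    then have "\<forall>i<k. v $ i = 0" using sp unfolding spanning_def by blast
    then show False using v by (auto intro: eq_vecI)
  qed
  then obtain B where B: "B \<in> carrier_mat k k" "B * P = 1\<^sub>m k" "P * B = 1\<^sub>m k"
    using det_non_zero_imp_unit[OF P, where b = "()"] by (auto simp: Units_def ring_mat_def)
  show thesis
  proof (rule that[of "\<lambda>x i. B $$ (i, g x)"])
    fix x y assume xy: "x \<in> F" "y \<in> F"
    have "(\<Sum>i<k. p x i * B $$ (i, g y)) = (P * B) $$ (g x, g y)"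
      using xy g B(1) P by (simp add: P_def scalar_prod_def lessThan_atLeast0)
    also have "\<dots> = of_bool (g x = g y)"
      unfolding B(3) using g(1)[OF xy(1)] g(1)[OF xy(2)] by simp
    also have "g x = g y \<longleftrightarrow> x = y"
      by (rule inj_on_eq_iff[OF inj_g xy])
    finally show "(\<Sum>i<k. p x i * B $$ (i, g y)) = of_bool (x = y)" .
  next
    fix i j assume ij: "i < k" "j < k"
    have "(\<Sum>x\<in>F. B $$ (i, g x) * p x j) = (\<Sum>a<k. B $$ (i, g (h a)) * p (h a) j)"
      by (rule sum.reindex_bij_betw[OF h, symmetric])
    also have "\<dots> = (\<Sum>a<k. B $$ (i, a) * p (h a) j)" by (intro sum.cong) (auto simp: gh)
    also have "\<dots> = (B * P) $$ (i, j)"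
      using ij B(1) P by (simp add: P_def scalar_prod_def lessThan_atLeast0)
    also have "\<dots> = of_bool (i = j)" using B(2) ij by simp
    finally show "(\<Sum>x\<in>F. B $$ (i, g x) * p x j) = of_bool (i = j)" .
  qed
qed

section \<open>Trivial infinitesimal motions\<close>

definition skew :: "nat \<Rightarrow> (nat \<Rightarrow> nat \<Rightarrow> real) \<Rightarrow> bool" where
  "skew k S \<longleftrightarrow> (\<forall>i<k. \<forall>j<k. S i j = - S j i)"

definition flow :: "nat \<Rightarrow> (nat \<Rightarrow> nat \<Rightarrow> real) \<Rightarrow> (nat \<Rightarrow> real) \<Rightarrow> (nat \<Rightarrow> real) \<Rightarrow> nat \<Rightarrow> real" where
  "flow k S t v i = (\<Sum>j<k. S i j * v j) + t i"

lemma skew_bilinear: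
  assumes "skew k S"
  shows "(\<Sum>i<k. a i * (\<Sum>j<k. S i j * b j)) = - (\<Sum>i<k. b i * (\<Sum>j<k. S i j * a j))"
proof -
  have "(\<Sum>i<k. a i * (\<Sum>j<k. S i j * b j)) = (\<Sum>i<k. \<Sum>j<k. a i * S i j * b j)"
    by (simp add: sum_distrib_left mult.assoc)
  also have "\<dots> = (\<Sum>j<k. \<Sum>i<k. a i * S i j * b j)" by (rule sum.swap)
  also have "\<dots> = (\<Sum>j<k. \<Sum>i<k. - (b j * (S j i * a i)))"
  proof (intro sum.cong refl)
    fix i j assume "i \<in> {..<k}" "j \<in> {..<k}"
    then have "S i j = - S j i" using assms unfolding skew_def by blast
    then show "a i * S i j * b j = - (b j * (S j i * a i))" by (simp add: mult.commute mult.left_commute)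
  qed
  finally show ?thesis by (simp add: sum_distrib_left sum_negf)
qed

lemma flow_motion:
  assumes "skew k S"
  shows "(\<Sum>i<k. (a i - b i) * (flow k S t a i - flow k S t b i)) = 0"
proof -
  have "(\<Sum>i<k. (a i - b i) * (flow k S t a i - flow k S t b i))
      = (\<Sum>i<k. (a i - b i) * (\<Sum>j<k. S i j * (a j - b j)))"
    by (simp add: flow_def right_diff_distrib sum_subtractf)
  then show ?thesis using skew_bilinear[OF assms, of "\<lambda>i. a i - b i" "\<lambda>i. a i - b i"] by simp
qed

text \<open>Pairing \<open>S x + t = 0\<close> with the point \<open>x\<close> removes the skew
  term, so \<open>t\<close> is orthogonal to a spanning set and vanishes. The rows of
  \<open>S\<close> are then orthogonal to the same set.\<close>

lemma flow_eq_0: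
  assumes S: "skew k S" and sp: "spanning k F p"
    and zero: "\<And>x i. x \<in> F \<Longrightarrow> i < k \<Longrightarrow> flow k S t (p x) i = 0" and i: "i < k"
  shows "flow k S t v i = 0"
proof -
  have Sp: "(\<Sum>j<k. S i j * p x j) = - t i" if "x \<in> F" "i < k" for x i
    using zero[OF that] by (simp add: flow_def)
  have "(\<Sum>i<k. p x i * t i) = 0" if x: "x \<in> F" for x
  proof -
    have "(\<Sum>i<k. p x i * (\<Sum>j<k. S i j * p x j)) = 0"
      using skew_bilinear[OF S, of "p x" "p x"] by simp
    moreover have "(\<Sum>i<k. p x i * (\<Sum>j<k. S i j * p x j)) = - (\<Sum>i<k. p x i * t i)"
      using Sp[OF x] by (simp add: sum_negf)
    ultimately show ?thesis by simp
  qed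
  then have t: "t i = 0" if "i < k" for i
    using sp that unfolding spanning_def by blast
  have "\<forall>x\<in>F. (\<Sum>j<k. p x j * S i j) = 0"
    using Sp t i by (simp add: mult.commute)
  then have "\<forall>j<k. S i j = 0" using sp unfolding spanning_def by blast
  then show ?thesis using t i by (simp add: flow_def)
qed

text \<open>With \<open>c x y\<close> the product of the position of \<open>x\<close> and the
  velocity of \<open>y\<close>, the edge condition reads
  \<open>c x x + c y y = c x y + c y x\<close>. A suitable translation makes the diagonal vanish,
  and then the linear map interpolating the velocities is skew.\<close>

lemma simplex_motion_trivial:
  assumes F: "card F = k" "finite F" and sp: "spanning k F p"
    and motion: "\<And>x y. x \<in> F \<Longrightarrow> y \<in> F \<Longrightarrow> (\<Sum>i<k. (p x i - p y i) * (q x i - q y i)) = 0"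
  obtains S t where "skew k S" "\<And>x i. x \<in> F \<Longrightarrow> i < k \<Longrightarrow> q x i = flow k S t (p x) i"
proof -
  obtain d where d1: "\<And>x y. x \<in> F \<Longrightarrow> y \<in> F \<Longrightarrow> (\<Sum>i<k. p x i * d y i) = of_bool (x = y)"
    and d2: "\<And>i j. i < k \<Longrightarrow> j < k \<Longrightarrow> (\<Sum>x\<in>F. d x i * p x j) = of_bool (i = j)"
    by (rule dual_basis[OF F sp]) auto
  define c where "c = (\<lambda>x y. \<Sum>i<k. p x i * q y i)"
  have cc: "c x x + c y y = c x y + c y x" if "x \<in> F" "y \<in> F" for x y
    using motion[OF that] by (simp add: c_def algebra_simps sum.distrib sum_subtractf)
  \<comment> \<open>The translation whose product with each \<open>p y\<close> is
    \<open>c y y\<close>, expanded in the dual basis.\<close>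
  define t where "t = (\<lambda>i. \<Sum>x\<in>F. c x x * d x i)"
  have pt: "(\<Sum>i<k. p y i * t i) = c y y" if "y \<in> F" for y
  proof -
    have "(\<Sum>i<k. p y i * t i) = (\<Sum>i<k. \<Sum>x\<in>F. c x x * (p y i * d x i))"
      by (simp add: t_def sum_distrib_left algebra_simps)
    also have "\<dots> = (\<Sum>x\<in>F. \<Sum>i<k. c x x * (p y i * d x i))" by (rule sum.swap)
    also have "\<dots> = (\<Sum>x\<in>F. c x x * of_bool (y = x))"
      using that by (intro sum.cong refl) (simp add: sum_distrib_left[symmetric] d1)
    also have "\<dots> = c y y" using that F by (simp add: of_bool_def if_distrib cong: if_cong)
    finally show ?thesis .
  qed
  define q' where "q' = (\<lambda>x i. q x i - t i)"
  define c' where "c' = (\<lambda>x y. \<Sum>i<k. p x i * q' y i)"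
  have c': "c' x y = c x y - c x x" if "x \<in> F" for x y
    using pt[OF that] by (simp add: c'_def q'_def c_def algebra_simps sum_subtractf)
  \<comment> \<open>The linear map sending each \<open>p x\<close> to \<open>q' x\<close>; its
    coefficients in the dual basis are the antisymmetric \<open>c'\<close>.\<close>
  define S where "S = (\<lambda>i j. \<Sum>x\<in>F. q' x i * d x j)"
  have q'd: "q' x i = (\<Sum>y\<in>F. d y i * c' y x)" if "i < k" for x i
  proof -
    have "(\<Sum>y\<in>F. d y i * c' y x) = (\<Sum>y\<in>F. \<Sum>m<k. d y i * p y m * q' x m)"
      by (simp add: c'_def sum_distrib_left algebra_simps)
    also have "\<dots> = (\<Sum>m<k. \<Sum>y\<in>F. d y i * p y m * q' x m)" by (rule sum.swap)
    also have "\<dots> = (\<Sum>m<k. of_bool (i = m) * q' x m)"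
      using that by (intro sum.cong refl) (simp add: sum_distrib_right[symmetric] d2)
    also have "\<dots> = q' x i" using that by (simp add: of_bool_def if_distrib if_distribR cong: if_cong)
    finally show ?thesis ..
  qed
  have Sexp: "S i j = (\<Sum>x\<in>F. \<Sum>y\<in>F. c' y x * d y i * d x j)" if "i < k" for i j
    unfolding S_def by (simp add: q'd[OF that] sum_distrib_right sum_distrib_left algebra_simps)
  have "S i j = - S j i" if ij: "i < k" "j < k" for i j
  proof -
    have "S j i = (\<Sum>x\<in>F. \<Sum>y\<in>F. c' x y * d x j * d y i)"
      unfolding Sexp[OF ij(2)] by (rule sum.swap)
    also have "\<dots> = (\<Sum>x\<in>F. \<Sum>y\<in>F. - (c' y x * d y i * d x j))"
    proof (intro sum.cong refl)
      fix x y assume xy: "x \<in> F" "y \<in> F"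
      then have "c' x y + c' y x = 0" using cc[OF xy] by (simp add: c')
      then have "c' x y = - c' y x" by simp
      then show "c' x y * d x j * d y i = - (c' y x * d y i * d x j)" by simp
    qed
    finally show ?thesis unfolding Sexp[OF ij(1)] by (simp add: sum_negf)
  qed
  then have skew: "skew k S" unfolding skew_def by blast
  have "q y i = flow k S t (p y) i" if y: "y \<in> F" for y i
  proof -
    have "(\<Sum>j<k. S i j * p y j) = (\<Sum>j<k. \<Sum>x\<in>F. q' x i * (p y j * d x j))"
      by (simp add: S_def sum_distrib_right sum_distrib_left algebra_simps)
    also have "\<dots> = (\<Sum>x\<in>F. \<Sum>j<k. q' x i * (p y j * d x j))" by (rule sum.swap)
    also have "\<dots> = (\<Sum>x\<in>F. q' x i * of_bool (y = x))"
      using y by (intro sum.cong refl) (simp add: sum_distrib_left[symmetric] d1)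
    also have "\<dots> = q' y i" using y F by (simp add: of_bool_def if_distrib cong: if_cong)
    finally show ?thesis by (simp add: flow_def q'_def)
  qed
  then show thesis by (rule that[OF skew])
qed

section \<open>From pinned frameworks to trivial motions\<close>

definition clique :: "('a \<Rightarrow> 'a \<Rightarrow> bool) \<Rightarrow> 'a set \<Rightarrow> bool" where
  "clique E F \<longleftrightarrow> (\<forall>x\<in>F. \<forall>y\<in>F. E x y)"

text \<open>Subtract the trivial motion that agrees with \<open>q\<close> on the pinned clique: the
  remainder is a motion vanishing on \<open>F\<close>, hence on \<open>X\<close>.\<close>

lemma locked_motion_trivial:
  assumes lock: "locked k E X F p" and F: "card F = k" "finite F" "F \<subseteq> X" "clique E F"
    and sp: "spanning k F p"
    and motion: "\<And>x y. x \<in> X \<Longrightarrow> y \<in> X \<Longrightarrow> E x y \<Longrightarrow> (\<Sum>i<k. (p x i - p y i) * (q x i - q y i)) = 0"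
  obtains S t where "skew k S" "\<And>x i. x \<in> X \<Longrightarrow> i < k \<Longrightarrow> q x i = flow k S t (p x) i"
proof -
  have "(\<Sum>i<k. (p x i - p y i) * (q x i - q y i)) = 0" if "x \<in> F" "y \<in> F" for x y
    using motion[of x y] that F(3,4) unfolding clique_def by (simp add: subset_iff)
  then obtain S t where S: "skew k S" and q: "\<And>x i. x \<in> F \<Longrightarrow> i < k \<Longrightarrow> q x i = flow k S t (p x) i"
    by (rule simplex_motion_trivial[OF F(1,2) sp]) auto
  define r where "r = (\<lambda>x i. q x i - flow k S t (p x) i)"
  have "(\<Sum>i<k. (p x i - p y i) * (r x i - r y i)) = 0" if "x \<in> X" "y \<in> X" "E x y" for x y
  proof -
    have "(\<Sum>i<k. (p x i - p y i) * (r x i - r y i)) = (\<Sum>i<k. (p x i - p y i) * (q x i - q y i))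
        - (\<Sum>i<k. (p x i - p y i) * (flow k S t (p x) i - flow k S t (p y) i))"
      by (simp add: r_def sum_subtractf[symmetric] algebra_simps)
    then show ?thesis using motion[OF that] flow_motion[OF S] by simp
  qed
  moreover have "\<forall>x\<in>F. \<forall>i<k. r x i = 0" using q by (simp add: r_def)
  ultimately have "\<forall>x\<in>X. \<forall>i<k. r x i = 0"
    using lock[unfolded locked_dir_def, THEN spec, of r] by simp
  then show thesis using that[OF S] by (simp add: r_def)
qed

text \<open>All motions of \<open>X\<close> are trivial by the previous lemma, and a trivial motion
  vanishing on a spanning set is zero, so the pins can move from the clique \<open>F\<close> to
  \<open>F'\<close>.\<close>

lemma locked_base_change:
  assumes lock: "locked k E X F p" and F: "card F = k" "finite F" "F \<subseteq> X" "clique E F"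
    and sp: "spanning k F p" "spanning k F' p" and F': "F' \<subseteq> X"
  shows "locked k E X F' p"
  unfolding locked_dir_def
proof (intro allI impI)
  fix q assume q: "(\<forall>x\<in>X. \<forall>y\<in>X. E x y \<longrightarrow> (\<Sum>i<k. (p x i - p y i) * (q x i - q y i)) = 0) \<and>
    (\<forall>x\<in>F'. \<forall>i<k. q x i = 0)"
  have "(\<Sum>i<k. (p x i - p y i) * (q x i - q y i)) = 0" if "x \<in> X" "y \<in> X" "E x y" for x y
    by (rule q[THEN conjunct1, rule_format, OF that])
  then obtain S t where S: "skew k S" and qf: "\<And>x i. x \<in> X \<Longrightarrow> i < k \<Longrightarrow> q x i = flow k S t (p x) i"
    by (rule locked_motion_trivial[OF lock F sp(1)]) auto
  have "flow k S t (p x) i = 0" if "x \<in> F'" "i < k" for x i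
    using q[THEN conjunct2, rule_format, OF that] qf[OF subsetD[OF F' that(1)] that(2)] by simp
  then have "flow k S t v i = 0" if "i < k" for v i
    by (rule flow_eq_0[OF S sp(2) _ that])
  then show "\<forall>x\<in>X. \<forall>i<k. q x i = 0"
    by (simp add: qf)
qed

text \<open>The loops \<open>E x x\<close> record that the members of \<open>X\<close> are vertices
  of the graph. They keep \<open>v\<close> out of \<open>X\<close> after contraction, and vertices
  of unselected colors out of \<open>X\<close> in the rank selection.\<close>

definition rigid_set :: "nat \<Rightarrow> ('a \<Rightarrow> 'a \<Rightarrow> bool) \<Rightarrow> 'a set \<Rightarrow> bool" where
  "rigid_set k E X \<longleftrightarrow> finite X \<and> (\<forall>x\<in>X. E x x) \<and>
     (\<exists>F\<subseteq>X. card F = k \<and> clique E F \<and> generic (locked k E X F))"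

lemma rigid_set_locked:
  assumes X: "rigid_set k E X" and k: "k > 0" and F': "F' \<subseteq> X" "card F' = k"
  shows "generic (locked k E X F')"
proof -
  obtain F where F: "F \<subseteq> X" "card F = k" "clique E F" and gen: "generic (locked k E X F)"
    using X unfolding rigid_set_def by (elim conjE exE) (rule that)
  have fin: "finite F" using F(2) k card_ge_0_finite by blast
  from generic_conj[OF gen generic_conj[OF generic_spanning[OF F(2) k] generic_spanning[OF F'(2) k]]]
  show ?thesis
  proof (rule generic_mono)
    fix p assume "locked k E X F p \<and> spanning k F p \<and> spanning k F' p"
    then show "locked k E X F' p"
      using locked_base_change[of k E X F p F'] F F' fin by simp
  qed
qed

text \<open>Both sets can be pinned at the shared \<open>F\<close>, and a motion of the union
  restricts to a motion of each.\<close>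

lemma rigid_set_Un:
  assumes "rigid_set k E X" "rigid_set k E Y" "k > 0"
    and F: "F \<subseteq> X" "F \<subseteq> Y" "card F = k" "clique E F"
  shows "rigid_set k E (X \<union> Y)"
proof -
  have X: "generic (locked k E X F)" by (rule rigid_set_locked[OF assms(1,3) F(1,3)])
  have Y: "generic (locked k E Y F)" by (rule rigid_set_locked[OF assms(2,3) F(2,3)])
  from generic_conj[OF X Y] have gen: "generic (locked k E (X \<union> Y) F)"
  proof (rule generic_mono)
    fix p assume p: "locked k E X F p \<and> locked k E Y F p"
    show "locked k E (X \<union> Y) F p"
      unfolding locked_dir_def
    proof (intro allI impI)
      fix q assume q: "(\<forall>x\<in>X \<union> Y. \<forall>y\<in>X \<union> Y. E x y \<longrightarrow> (\<Sum>i<k. (p x i - p y i) * (q x i - q y i)) = 0) \<and>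
        (\<forall>x\<in>F. \<forall>i<k. q x i = 0)"
      have mX: "(\<forall>x\<in>X. \<forall>y\<in>X. E x y \<longrightarrow> (\<Sum>i<k. (p x i - p y i) * (q x i - q y i)) = 0) \<and>
        (\<forall>x\<in>F. \<forall>i<k. q x i = 0)" using q by blast
      have mY: "(\<forall>x\<in>Y. \<forall>y\<in>Y. E x y \<longrightarrow> (\<Sum>i<k. (p x i - p y i) * (q x i - q y i)) = 0) \<and>
        (\<forall>x\<in>F. \<forall>i<k. q x i = 0)" using q by blast
      have "\<forall>x\<in>X. \<forall>i<k. q x i = 0"
        by (rule conjunct1[OF p, unfolded locked_dir_def, THEN spec, THEN mp, OF mX])
      moreover have "\<forall>x\<in>Y. \<forall>i<k. q x i = 0"
        by (rule conjunct2[OF p, unfolded locked_dir_def, THEN spec, THEN mp, OF mY])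
      ultimately show "\<forall>x\<in>X \<union> Y. \<forall>i<k. q x i = 0" by blast
    qed
  qed
  have "finite (X \<union> Y)" "\<forall>x\<in>X \<union> Y. E x x" using assms(1,2) by (auto simp: rigid_set_def)
  with gen F show ?thesis unfolding rigid_set_def by (intro conjI exI[of _ F]) auto
qed

lemma rigid_set_clique:
  assumes "card F = k" "k > 0" "clique E F"
  shows "rigid_set k E F"
proof -
  have "generic (locked k E F F)"
    by (rule generic_mono[OF generic_True]) (auto simp: locked_dir_def)
  then show ?thesis
    using assms card_ge_0_finite[of F] unfolding rigid_set_def clique_def by auto
qed

section \<open>The linkage relation\<close>

definition linked :: "nat \<Rightarrow> ('a \<Rightarrow> 'a \<Rightarrow> bool) \<Rightarrow> 'a set \<Rightarrow> 'a set \<Rightarrow> bool" where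
  "linked k E F F' \<longleftrightarrow> (\<exists>X. rigid_set k E X \<and> F \<subseteq> X \<and> F' \<subseteq> X)"

lemma linked_refl: "card F = k \<Longrightarrow> k > 0 \<Longrightarrow> clique E F \<Longrightarrow> linked k E F F"
  unfolding linked_def using rigid_set_clique by blast

lemma linked_sym: "linked k E F F' \<Longrightarrow> linked k E F' F"
  unfolding linked_def by blast

lemma linked_trans:
  assumes "linked k E F F'" "linked k E F' F''" "k > 0" "card F' = k" "clique E F'"
  shows "linked k E F F''"
proof -
  obtain X Y where X: "rigid_set k E X" "F \<subseteq> X" "F' \<subseteq> X" and Y: "rigid_set k E Y" "F' \<subseteq> Y" "F'' \<subseteq> Y"
    using assms(1,2) unfolding linked_def by auto
  have "rigid_set k E (X \<union> Y)"
    by (rule rigid_set_Un[OF X(1) Y(1) assms(3) X(3) Y(2) assms(4,5)])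
  then show ?thesis unfolding linked_def using X Y by (intro exI[of _ "X \<union> Y"]) auto
qed

lemma linked_collect:
  assumes "finite \<F>" and F: "k > 0" "card F = k" "clique E F" and "\<And>F'. F' \<in> \<F> \<Longrightarrow> linked k E F F'"
  shows "\<exists>X. rigid_set k E X \<and> F \<subseteq> X \<and> \<Union>\<F> \<subseteq> X"
  using assms(1,5)
proof (induction rule: finite_induct)
  case empty
  then show ?case using rigid_set_clique[OF F(2,1,3)] by auto
next
  case (insert F' \<F>)
  then obtain X where X: "rigid_set k E X" "F \<subseteq> X" "\<Union>\<F> \<subseteq> X" by auto
  obtain Y where Y: "rigid_set k E Y" "F \<subseteq> Y" "F' \<subseteq> Y"
    using insert.prems unfolding linked_def by blast
  have "rigid_set k E (X \<union> Y)" by (rule rigid_set_Un[OF X(1) Y(1) F(1) X(2) Y(2) F(2,3)])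
  then show ?case using X Y by (intro exI[of _ "X \<union> Y"]) auto
qed

section \<open>Vertex splitting\<close>

definition merge :: "'a \<Rightarrow> 'a \<Rightarrow> 'a \<Rightarrow> 'a" where
  "merge u v x = (if x = v then u else x)"

text \<open>For \<open>u\<close> and \<open>v\<close> distinct and adjacent, their edge becomes a
  loop at \<open>u\<close>, and no pair involving \<open>v\<close> remains, not even its
  loop.\<close>

definition merge_rel :: "'a \<Rightarrow> 'a \<Rightarrow> ('a \<Rightarrow> 'a \<Rightarrow> bool) \<Rightarrow> 'a \<Rightarrow> 'a \<Rightarrow> bool" where
  "merge_rel u v E x y \<longleftrightarrow> (\<exists>x' y'. E x' y' \<and> merge u v x' = x \<and> merge u v y' = y)"

lemma univariate_algebra: "function_algebra (\<lambda>f. \<exists>r. \<forall>t. f t = poly r t)"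
proof -
  have "\<exists>r. \<forall>t::real. a = poly r t" for a :: real
    by (rule exI[of _ "[:a:]"]) simp
  moreover have "(\<exists>r. \<forall>t. f t * g t = poly r t) \<and> (\<exists>r. \<forall>t. f t - g t = poly r t)"
    if fg: "\<exists>r. \<forall>t. f t = poly r t" "\<exists>r. \<forall>t. g t = poly r t" for f g :: "real \<Rightarrow> real"
  proof -
    obtain r s where rs: "\<forall>t. f t = poly r t" "\<forall>t. g t = poly s t" using fg by blast
    show ?thesis
    proof
      show "\<exists>r. \<forall>t. f t * g t = poly r t" using rs by (intro exI[of _ "r * s"]) simp
      show "\<exists>r. \<forall>t. f t - g t = poly r t" using rs by (intro exI[of _ "r - s"]) simp
    qed
  qed
  ultimately show ?thesis unfolding function_algebra_def by blast
qed

text \<open>Whiteley's vertex splitting. If \<open>v\<close> is placed on top of \<open>u\<close> and the edge \<open>uv\<close> gets the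
  direction \<open>p u\<close>, the common neighbours force equal velocities at \<open>u\<close> and \<open>v\<close>, so the contracted
  graph takes over; then \<open>v\<close> is moved to \<open>(1 + \<epsilon>) p u\<close>.\<close>

lemma rigid_set_split:
  assumes uv: "u \<noteq> v" and k: "k > 0" and sym: "\<And>x y. E x y \<Longrightarrow> E y x"
    and X: "rigid_set k (merge_rel u v E) X"
    and W: "insert u W \<subseteq> X" "card (insert u W) = k" "\<And>w. w \<in> W \<Longrightarrow> E u w \<and> E v w"
    and Euv: "E u v" "E u u" "E v v"
    and F: "card F = k" "clique E F" "\<not> (u \<in> F \<and> v \<in> F)" "merge u v ` F \<subseteq> X"
  shows "rigid_set k E (insert v X)"
proof -
  let ?E = "merge_rel u v E"
  have finX: "finite X" and EX: "\<And>x. x \<in> X \<Longrightarrow> ?E x x" using X unfolding rigid_set_def by auto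
  have not_v: "\<not> ?E v v" using uv unfolding merge_rel_def merge_def by auto
  then have vX: "v \<notin> X" using EX by blast
  have uX: "u \<in> X" using W by blast
  have refl: "E x x" if "x \<in> insert v X" for x
  proof (cases "x = u \<or> x = v")
    case False
    then have "?E x x" using EX that by auto
    then show ?thesis using False unfolding merge_rel_def merge_def by (auto split: if_splits)
  qed (use Euv in auto)
  have FX: "F \<subseteq> insert v X"
  proof
    fix x assume "x \<in> F"
    then have "merge u v x \<in> X" using F(4) by blast
    then show "x \<in> insert v X" by (auto simp: merge_def split: if_splits)
  qed
  \<comment> \<open>The pins must remain \<open>k\<close> different vertices after merging, which is
    why \<open>F\<close> may not contain both \<open>u\<close> and \<open>v\<close>.\<close>
  have "inj_on (merge u v) F" using F(3) by (auto simp: inj_on_def merge_def)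
  then have cardF: "card (merge u v ` F) = k" using F(1) by (simp add: card_image)
  from generic_conj[OF rigid_set_locked[OF X k F(4) cardF] generic_spanning[OF W(2) k]]
  obtain p where lock: "locked k ?E X (merge u v ` F) p" and sp: "spanning k (insert u W) p"
    using generic_ex by blast
  define P where "P = (\<lambda>\<epsilon> x i. if x = v then (1 + \<epsilon>) * p u i else p x i)"
  \<comment> \<open>For \<epsilon> \<noteq> 0 the true edge vector of \<open>uv\<close> is
    \<epsilon> times this direction. Dividing by \<epsilon> keeps the equation of this edge alive at
    \<epsilon> = 0.\<close>
  define \<delta> where "\<delta> = (\<lambda>\<epsilon> x y i. if x = u \<and> y = v then - p u i else if x = v \<and> y = u then p u i
      else P \<epsilon> x i - P \<epsilon> y i)"
  have P0: "P 0 x i = p (merge u v x) i" for x i by (simp add: P_def merge_def)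
  have lock0: "locked_dir k E (insert v X) F (\<delta> 0)"
    unfolding locked_dir_def
  proof (intro allI impI)
    fix q :: "'a \<Rightarrow> nat \<Rightarrow> real"
    assume q: "(\<forall>x\<in>insert v X. \<forall>y\<in>insert v X. E x y \<longrightarrow> (\<Sum>i<k. \<delta> 0 x y i * (q x i - q y i)) = 0) \<and>
       (\<forall>x\<in>F. \<forall>i<k. q x i = 0)"
    have motion: "(\<Sum>i<k. \<delta> 0 x y i * (q x i - q y i)) = 0" if "x \<in> insert v X" "y \<in> insert v X" "E x y" for x y
      using conjunct1[OF q] that by blast
    have qF: "q x i = 0" if "x \<in> F" "i < k" for x i using conjunct2[OF q] that by blast
    have "(\<Sum>i<k. - p u i * (q u i - q v i)) = 0"
      using motion[of u v] uX uv Euv(1) by (simp add: \<delta>_def)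
    then have pu: "(\<Sum>i<k. p u i * (q u i - q v i)) = 0" by (simp add: sum_negf)
    \<comment> \<open>The edge \<open>uv\<close> makes \<open>q u - q v\<close> orthogonal to
      \<open>p u\<close>; the two edges at \<open>w\<close> make it orthogonal to
      \<open>p u - p w\<close>, hence to \<open>p w\<close>.\<close>
    have "(\<Sum>i<k. p w i * (q u i - q v i)) = 0" if w: "w \<in> W" for w
    proof -
      have wX: "w \<in> X" "w \<noteq> v" using W(1) w vX by auto
      show ?thesis
      proof (cases "w = u")
        case True
        then show ?thesis using pu by simp
      next
        case False
        have "(\<Sum>i<k. (p u i - p w i) * (q u i - q w i)) = 0"
          using motion[of u w] uX wX W(3)[OF w] uv False by (simp add: \<delta>_def P0 merge_def)
        moreover have "(\<Sum>i<k. (p u i - p w i) * (q v i - q w i)) = 0"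
          using motion[of v w] wX W(3)[OF w] uv False by (simp add: \<delta>_def P0 merge_def)
        moreover have "(\<Sum>i<k. p w i * (q u i - q v i)) = (\<Sum>i<k. p u i * (q u i - q v i))
          - (\<Sum>i<k. (p u i - p w i) * (q u i - q w i)) + (\<Sum>i<k. (p u i - p w i) * (q v i - q w i))"
          by (simp add: sum_subtractf[symmetric] sum.distrib[symmetric] algebra_simps)
        ultimately show ?thesis using pu by simp
      qed
    qed
    then have "\<forall>x\<in>insert u W. (\<Sum>i<k. p x i * (q u i - q v i)) = 0" using pu by blast
    then have "\<forall>i<k. q u i - q v i = 0"
      using sp[unfolded spanning_def, THEN spec, of "\<lambda>i. q u i - q v i"] by blast
    then have quv: "q v i = q u i" if "i < k" for i using that by simp
    then have qm: "q x i = q (merge u v x) i" if "i < k" for x i using that by (simp add: merge_def)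
    have "(\<Sum>i<k. (p x i - p y i) * (q x i - q y i)) = 0" if xy: "x \<in> X" "y \<in> X" "?E x y" for x y
    proof -
      obtain x' y' where xy': "E x' y'" "merge u v x' = x" "merge u v y' = y"
        using xy(3) unfolding merge_rel_def by blast
      show ?thesis
      proof (cases "x = y")
        case False
        then have "\<not> (x' = u \<and> y' = v)" "\<not> (x' = v \<and> y' = u)"
          using xy'(2,3) by (auto simp: merge_def)
        then have "\<delta> 0 x' y' i = P 0 x' i - P 0 y' i" for i
          unfolding \<delta>_def by (simp only: if_False)
        then have \<delta>0: "\<delta> 0 x' y' i = p x i - p y i" for i
          unfolding P0 xy'(2,3) .
        have "x' \<in> insert v X" "y' \<in> insert v X"
          using xy' xy by (auto simp: merge_def split: if_splits)
        then have "(\<Sum>i<k. \<delta> 0 x' y' i * (q x' i - q y' i)) = 0" using motion xy'(1) by blast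
        then have "(\<Sum>i<k. (p x i - p y i) * (q (merge u v x') i - q (merge u v y') i)) = 0"
          by (simp only: \<delta>0) (simp add: qm[symmetric])
        then show ?thesis unfolding xy'(2,3) .
      qed simp
    qed
    moreover have "\<forall>x\<in>merge u v ` F. \<forall>i<k. q x i = 0" using qF by (simp add: qm[symmetric])
    ultimately have "\<forall>x\<in>X. \<forall>i<k. q x i = 0"
      using lock[unfolded locked_dir_def, THEN spec, of q] by blast
    then show "\<forall>x\<in>insert v X. \<forall>i<k. q x i = 0" using quv uX by auto
  qed
  have dir: "\<exists>r. \<forall>\<epsilon>. \<delta> \<epsilon> x y i = poly r \<epsilon>" for x y i
  proof -
    have lin: "\<exists>r. \<forall>\<epsilon>::real. a + \<epsilon> * b = poly r \<epsilon>" for a b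
      by (rule exI[of _ "[:a, b:]"]) simp
    \<comment> \<open>Each coordinate of \<delta> is affine in \<epsilon>, so its values at 0 and 1
      determine it.\<close>
    obtain r where r: "\<forall>\<epsilon>. \<delta> 0 x y i + \<epsilon> * (\<delta> 1 x y i - \<delta> 0 x y i) = poly r \<epsilon>"
      using lin by blast
    have "\<delta> \<epsilon> x y i = \<delta> 0 x y i + \<epsilon> * (\<delta> 1 x y i - \<delta> 0 x y i)" for \<epsilon>
      by (simp add: \<delta>_def P_def algebra_simps)
    from trans[OF this r[THEN spec]] show ?thesis by blast
  qed
  obtain f where f: "\<exists>r. \<forall>\<epsilon>. f \<epsilon> = poly r \<epsilon>" "f 0 \<noteq> 0"
    and flock: "\<And>\<epsilon>. f \<epsilon> \<noteq> 0 \<Longrightarrow> locked_dir k E (insert v X) F (\<delta> \<epsilon>)"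
    using locked_dir_open[of "insert v X" F "\<lambda>f. \<exists>r. \<forall>t. f t = poly r t" \<delta> k E 0,
        OF finite.insertI[OF finX] FX univariate_algebra dir lock0] by blast
  obtain r where r: "\<And>\<epsilon>. f \<epsilon> = poly r \<epsilon>" using f(1) by blast
  \<comment> \<open>The factor \<open>[:0, 1:]\<close> excludes the degenerate parameter 0.\<close>
  have "r * [:0, 1:] \<noteq> 0" using f(2) r[of 0] by auto
  then obtain \<epsilon> where "poly (r * [:0, 1:]) \<epsilon> \<noteq> 0" using poly_all_0_iff_0 by blast
  then have \<epsilon>: "\<epsilon> \<noteq> 0" "f \<epsilon> \<noteq> 0" using r by auto
  have "locked k E (insert v X) F (P \<epsilon>)"
    unfolding locked_dir_def
  proof (intro allI impI)
    fix q :: "'a \<Rightarrow> nat \<Rightarrow> real"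
    assume q: "(\<forall>x\<in>insert v X. \<forall>y\<in>insert v X. E x y \<longrightarrow> (\<Sum>i<k. (P \<epsilon> x i - P \<epsilon> y i) * (q x i - q y i)) = 0) \<and>
       (\<forall>x\<in>F. \<forall>i<k. q x i = 0)"
    have "(\<Sum>i<k. \<delta> \<epsilon> x y i * (q x i - q y i)) = 0" if xy: "x \<in> insert v X" "y \<in> insert v X" "E x y" for x y
    proof -
      have m: "(\<Sum>i<k. (P \<epsilon> x i - P \<epsilon> y i) * (q x i - q y i)) = 0" using conjunct1[OF q] xy by blast
      show ?thesis
      proof (cases "(x = u \<and> y = v) \<or> (x = v \<and> y = u)")
        case True
        then have eq: "P \<epsilon> x i - P \<epsilon> y i = \<epsilon> * \<delta> \<epsilon> x y i" for i
          using uv by (elim disjE conjE) (simp_all add: P_def \<delta>_def algebra_simps)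
        have "\<epsilon> * (\<Sum>i<k. \<delta> \<epsilon> x y i * (q x i - q y i)) = 0"
          unfolding sum_distrib_left mult.assoc[symmetric] eq[symmetric] by (rule m)
        then show ?thesis using \<epsilon>(1) by simp
      next
        case False
        then have eq: "\<delta> \<epsilon> x y i = P \<epsilon> x i - P \<epsilon> y i" for i
          unfolding \<delta>_def by (simp only: de_Morgan_disj if_False)
        show ?thesis unfolding eq by (rule m)
      qed
    qed
    then show "\<forall>x\<in>insert v X. \<forall>i<k. q x i = 0"
      using flock[OF \<epsilon>(2), unfolded locked_dir_def, THEN spec, of q] conjunct2[OF q] by blast
  qed
  then have "generic (locked k E (insert v X) F)"
    by (rule generic_locked[OF finite.insertI[OF finX] FX])
  then show ?thesis
    unfolding rigid_set_def using finX refl F(1,2) FX by (intro conjI exI[of _ F]) auto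
qed

section \<open>Fogelsanger's theorem for linkage classes\<close>

lemma bdry_nonzeroE:
  assumes "bdry V a R \<noteq> 0"
  obtains x where "x \<in> V" "x \<notin> R" "a (insert x R) \<noteq> 0"
proof -
  obtain x where "x \<in> V - R" "pm (card {y\<in>R. y < x}) (a (insert x R)) \<noteq> 0"
    using assms sum.not_neutral_contains_not_neutral unfolding bdry_def by blast
  then show thesis using that by auto
qed

definition chain_on :: "nat \<Rightarrow> 'a set \<Rightarrow> ('a set \<Rightarrow> 'g::zero) \<Rightarrow> bool" where
  "chain_on k V a \<longleftrightarrow> (\<forall>F. a F \<noteq> 0 \<longrightarrow> F \<subseteq> V \<and> card F = k)"

lemma chain_on_restr: "chain_on k V a \<Longrightarrow> chain_on k V (restr a S)"
  unfolding chain_on_def restr_def by auto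

lemma chain_on_bdry_nonzero:
  assumes "chain_on k V a" "finite V" "bdry V a R \<noteq> 0"
  shows "finite R" "R \<subseteq> V" "card R = k - 1"
proof -
  obtain x where x: "x \<in> V" "x \<notin> R" "a (insert x R) \<noteq> 0" using bdry_nonzeroE assms(3) by blast
  then have F: "insert x R \<subseteq> V" "card (insert x R) = k" using assms(1) unfolding chain_on_def by blast+
  then show "R \<subseteq> V" by blast
  then show "finite R" using assms(2) finite_subset by blast
  then show "card R = k - 1" using F x by simp
qed

text \<open>The faces contributing to \<open>contract u v c B\<close> all have merged image
  \<open>B\<close>, so a set that depends only on merged images keeps or drops them
  together.\<close>

lemma contract_restr:
  assumes "u < v"
    and S: "\<And>F. c F \<noteq> 0 \<Longrightarrow> \<not> (u \<in> F \<and> v \<in> F) \<Longrightarrow> F \<in> S \<longleftrightarrow> merge u v ` F \<in> S'"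
  shows "contract u v (restr c S) = restr (contract u v c) S'"
proof
  fix B
  have uv: "u \<noteq> v" using assms(1) by simp
  have same: "restr c S F = (if merge u v ` F \<in> S' then c F else 0)" if "\<not> (u \<in> F \<and> v \<in> F)" for F
    using S[of F] that by (cases "c F = 0") (auto simp: restr_def)
  show "contract u v (restr c S) B = restr (contract u v c) S' B"
  proof (cases "v \<in> B")
    case True
    then show ?thesis by (simp add: contract_def restr_def)
  next
    case v: False
    then have mB: "merge u v ` B = B" by (force simp: merge_def)
    have B: "restr c S B = (if B \<in> S' then c B else 0)"
      using same[of B] v mB by simp
    show ?thesis
    proof (cases "u \<in> B")
      case True
      have "merge u v ` insert v (B - {u}) = B"
        using True v by (force simp: merge_def)
      then have "restr c S (insert v (B - {u})) = (if B \<in> S' then c (insert v (B - {u})) else 0)"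
        using same[of "insert v (B - {u})"] uv by simp
      then show ?thesis using True v B by (simp add: contract_def restr_def)
    next
      case False
      then show ?thesis using v B by (simp add: contract_def restr_def)
    qed
  qed
qed

lemma contract_nonzeroE:
  assumes "u \<noteq> v" "contract u v c B \<noteq> 0"
  obtains F where "c F \<noteq> 0" "\<not> (u \<in> F \<and> v \<in> F)" "merge u v ` F = B"
proof -
  have v: "v \<notin> B" using assms(2) by (auto simp: contract_def)
  show thesis
  proof (cases "c B = 0")
    case False
    moreover have "merge u v ` B = B" using v by (force simp: merge_def)
    ultimately show thesis using that v by blast
  next
    case True
    then have u: "u \<in> B" and "c (insert v (B - {u})) \<noteq> 0"
      using assms(2) v by (auto simp: contract_def split: if_splits)
    moreover have "merge u v ` insert v (B - {u}) = B"
      using u v by (force simp: merge_def)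
    ultimately show thesis using that[of "insert v (B - {u})"] assms(1) by auto
  qed
qed

lemma card_merge_image: "\<not> (u \<in> F \<and> v \<in> F) \<Longrightarrow> card (merge u v ` F) = card F"
  by (rule card_image) (auto simp: inj_on_def merge_def)

lemma clique_merge: "clique E F \<Longrightarrow> clique (merge_rel u v E) (merge u v ` F)"
  unfolding clique_def merge_rel_def by blast

lemma bdry_contract_cycle:
  assumes V: "finite V" "u \<in> V" "v \<in> V" and uv: "u < v" and c: "chain_on k V c"
    and cyc: "\<And>R. bdry V c R = 0"
  shows "bdry V (contract u v c) R = 0"
proof (rule ccontr)
  assume nz: "bdry V (contract u v c) R \<noteq> 0"
  have "chain_on k V (contract u v c)"
    unfolding chain_on_def
  proof (intro allI impI)
    fix B assume "contract u v c B \<noteq> 0"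
    then obtain F where F: "c F \<noteq> 0" "\<not> (u \<in> F \<and> v \<in> F)" "merge u v ` F = B"
      using contract_nonzeroE[of u v c B] uv by blast
    then have "F \<subseteq> V" "card F = k" using c unfolding chain_on_def by blast+
    then show "B \<subseteq> V \<and> card B = k"
      using card_merge_image[OF F(2)] F(3) V(2) by (auto simp: merge_def)
  qed
  then have fin: "finite R" using chain_on_bdry_nonzero V(1) nz by blast
  show False
  proof (cases "v \<in> R")
    case True
    then show ?thesis using nz bdry_contract_snd by blast
  next
    case v: False
    show ?thesis
    proof (cases "u \<in> R")
      case True
      then have R: "R = insert u (R - {u})" by blast
      have "bdry V (contract u v c) (insert u (R - {u})) = 0"
        using v fin by (subst bdry_contract_on[OF V _ uv]) (simp_all add: cyc)
      then show ?thesis using nz R by simp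
    next
      case False
      then show ?thesis using nz cyc[of R] bdry_contract_off[OF V fin uv False v, of c] by argo
    qed
  qed
qed

text \<open>The boundary of the contracted chain at \<open>insert u G\<close> is the signed sum of
  both coefficients, so its vanishing ties them together. This is the suspension structure of the
  boundary over the two points.\<close>

lemma bdry_snd_nonzero:
  assumes V: "finite V" "u \<in> V" "v \<in> V" and uv: "u < v" and fin: "finite G"
    and cyc: "\<And>R. bdry V (contract u v a) R = 0" and G: "u \<notin> G" "v \<notin> G"
  shows "bdry V a (insert u G) = 0 \<longleftrightarrow> bdry V a (insert v G) = 0"
proof -
  have "bdry V a (insert u G) + pm (card {y\<in>G. u < y \<and> y < v}) (bdry V a (insert v G)) = 0"
    using bdry_contract_on[OF V fin uv G, of a] cyc by simp
  then show ?thesis using pm_eq_0_iff by force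
qed

text \<open>For a chain \<open>a\<close> without faces containing both \<open>u\<close> and \<open>v\<close> whose contraction is a cycle,
  the faces \<open>G\<close> with \<open>u, v \<notin> G\<close> and \<open>G \<union> {u}\<close> in the support of \<open>\<partial>a\<close> form the support of a
  \<open>(k-3)\<close>-cycle; a nonzero one has at least \<open>k - 1\<close> vertices.\<close>

lemma common_neighbours:
  assumes k: "k \<ge> 3" and V: "finite V" "u \<in> V" "v \<in> V" and uv: "u < v" and a: "chain_on k V a"
    and off: "\<And>F. a F \<noteq> 0 \<Longrightarrow> \<not> (u \<in> F \<and> v \<in> F)"
    and cyc: "\<And>R. bdry V (contract u v a) R = 0"
    and G: "u \<notin> G" "v \<notin> G" "bdry V a (insert u G) \<noteq> 0"
  obtains W where "u \<notin> W" "v \<notin> W" "card W = k - 1" "finite W"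
    "\<And>w. w \<in> W \<Longrightarrow> (\<exists>F. a F \<noteq> 0 \<and> u \<in> F \<and> w \<in> F) \<and> (\<exists>F. a F \<noteq> 0 \<and> v \<in> F \<and> w \<in> F)"
proof -
  let ?e = "bdry V a"
  note R = chain_on_bdry_nonzero[OF a V(1) G(3)]
  have finG: "finite G" and cG: "card G = k - 2" and GV: "G \<subseteq> V" using R G(1) by auto
  have faces: "(\<exists>F. a F \<noteq> 0 \<and> insert u H \<subseteq> F) \<and> (\<exists>F. a F \<noteq> 0 \<and> insert v H \<subseteq> F)"
    if H: "u \<notin> H" "v \<notin> H" "?e (insert u H) \<noteq> 0" for H
  proof -
    have "finite H" using chain_on_bdry_nonzero(1)[OF a V(1) H(3)] by simp
    then have "?e (insert v H) \<noteq> 0" using bdry_snd_nonzero[OF V uv _ cyc H(1,2)] H(3) by blast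
    then show ?thesis using H(3) bdry_nonzeroE subset_insertI by metis
  qed
  \<comment> \<open>The bound \<open>k \<ge> 3\<close> enters here: \<open>G\<close> has
    \<open>k - 2\<close> vertices, and one of them has to be exchanged.\<close>
  have "G \<noteq> {}" using cG k by auto
  then obtain y where y: "y \<in> G" by blast
  define S where "S = G - {y}"
  have GS: "G = insert y S" "y \<notin> S" using y by (auto simp: S_def)
  \<comment> \<open>In the boundary of the boundary at \<open>insert u S\<close> the term of
    \<open>y\<close> is nonzero, so another vertex \<open>x\<close> has a nonzero term too. Adding
    it to \<open>G\<close> gives the \<open>k - 1\<close> vertices.\<close>
  have "\<exists>x. x \<in> V \<and> x \<notin> insert u S \<and> x \<noteq> y \<and> ?e (insert x (insert u S)) \<noteq> 0"
  proof (rule ccontr)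
    assume "\<not> ?thesis"
    then have z: "?e (insert x (insert u S)) = 0" if "x \<in> V - insert u S" "x \<noteq> y" for x using that by blast
    have yV: "y \<in> V - insert u S" using y GV G GS by auto
    have "bdry V ?e (insert u S) = (\<Sum>x\<in>{y}. pm (card {z\<in>insert u S. z < x}) (?e (insert x (insert u S))))"
      unfolding bdry_def[of V ?e] using yV V(1) z by (intro sum.mono_neutral_right) auto
    also have "insert y (insert u S) = insert u G" using GS by blast
    then have "(\<Sum>x\<in>{y}. pm (card {z\<in>insert u S. z < x}) (?e (insert x (insert u S)))) \<noteq> 0"
      using G(3) by simp
    finally show False using bdry_bdry[OF V(1), of "insert u S" a] finG by (simp add: S_def)
  qed
  then obtain x where x: "x \<in> V" "x \<notin> insert u S" "x \<noteq> y" "?e (insert x (insert u S)) \<noteq> 0" by blast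
  \<comment> \<open>Otherwise some face of \<open>a\<close> would contain both \<open>u\<close> and
    \<open>v\<close>.\<close>
  have xv: "x \<noteq> v"
  proof
    assume "x = v"
    then obtain z where "a (insert z (insert v (insert u S))) \<noteq> 0" using x(4) bdry_nonzeroE by metis
    then show False using off by blast
  qed
  show thesis
  proof (rule that[of "insert x G"])
    show "u \<notin> insert x G" "v \<notin> insert x G" using G x xv by auto
    have "x \<notin> G" using x GS by auto
    then show "card (insert x G) = k - 1" using finG cG k by simp
    show "finite (insert x G)" using finG by simp
    have e2: "?e (insert u (insert x S)) \<noteq> 0" using x(4) by (simp add: insert_commute)
    have n2: "u \<notin> insert x S" "v \<notin> insert x S" using x xv G GS by auto
    fix w assume "w \<in> insert x G"
    then consider "w \<in> G" | "w \<in> insert x S" by blast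
    then show "(\<exists>F. a F \<noteq> 0 \<and> u \<in> F \<and> w \<in> F) \<and> (\<exists>F. a F \<noteq> 0 \<and> v \<in> F \<and> w \<in> F)"
    proof cases
      case 1
      then show ?thesis using faces[OF G] by blast
    next
      case 2
      then show ?thesis using faces[OF n2 e2] by blast
    qed
  qed
qed

text \<open>If the boundary lives only on faces containing \<open>u\<close> and \<open>v\<close>,
  then its own boundary at \<open>R - {v}\<close> has a single term, the one adding
  \<open>v\<close>, which must therefore vanish.\<close>

lemma bdry_eq_0_from_off:
  assumes V: "finite V" "v \<in> V" and a: "chain_on k V a"
    and off: "\<And>R. \<not> (u \<in> R \<and> v \<in> R) \<Longrightarrow> bdry V a R = 0" and "u \<noteq> v"
  shows "bdry V a R = 0"
proof (rule ccontr)
  let ?e = "bdry V a"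
  assume nz: "?e R \<noteq> 0"
  then have uvR: "u \<in> R" "v \<in> R" using off by blast+
  have fin: "finite R" using chain_on_bdry_nonzero(1)[OF a V(1) nz] .
  define S where "S = R - {v}"
  have S: "insert v S = R" "v \<notin> S" "u \<in> S" "finite S" using uvR fin assms(5) by (auto simp: S_def)
  have z: "?e (insert x S) = 0" if "x \<noteq> v" for x using off[of "insert x S"] that S by blast
  have "bdry V ?e S = (\<Sum>x\<in>{v}. pm (card {z\<in>S. z < x}) (?e (insert x S)))"
    unfolding bdry_def[of V ?e] using V S z by (intro sum.mono_neutral_right) auto
  then have "bdry V ?e S \<noteq> 0" using S nz by simp
  then show False using bdry_bdry[OF V(1) S(4)] by blast
qed

text \<open>On the support of \<open>c\<close> a union of linkage classes, elsewhere arbitrary.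
  Unions are stable under complements and under passing to subchains, and both are needed.\<close>

definition link_closed :: "nat \<Rightarrow> ('a \<Rightarrow> 'a \<Rightarrow> bool) \<Rightarrow> ('a set \<Rightarrow> 'g::zero) \<Rightarrow> 'a set set \<Rightarrow> bool" where
  "link_closed k E c A \<longleftrightarrow>
     (\<forall>F F'. F \<in> A \<longrightarrow> c F \<noteq> 0 \<longrightarrow> c F' \<noteq> 0 \<longrightarrow> linked k E F F' \<longrightarrow> F' \<in> A)"

text \<open>The relation \<open>E\<close> may contain more than the edges of the faces of
  \<open>c\<close>. This slack lets one relation serve a cycle and its subcycles, and all links in
  the rank selection.\<close>

locale complex_cycle =
  fixes k :: nat and V :: "'a::linorder set" and c :: "'a set \<Rightarrow> 'g::ab_group_add"
    and E :: "'a \<Rightarrow> 'a \<Rightarrow> bool"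
  assumes k: "k \<ge> 3" and finV: "finite V" and chain: "chain_on k V c"
    and cycle: "\<And>R. bdry V c R = 0"
    and sym: "\<And>x y. E x y \<Longrightarrow> E y x"
    and cliques: "\<And>F. c F \<noteq> 0 \<Longrightarrow> clique E F"
begin

lemma face: "c F \<noteq> 0 \<Longrightarrow> F \<subseteq> V \<and> card F = k \<and> finite F"
  using chain finV finite_subset unfolding chain_on_def by blast

lemma finite_support: "finite {F. c F \<noteq> 0}"
  by (rule finite_subset[of _ "Pow V"]) (use face finV in auto)

end

text \<open>The last two assumptions come from the induction further below: \<open>c\<close> has no
  proper nonzero subcycle, and the claim already holds for the contracted chain. \<open>F0\<close>
  is a face that collapses.\<close>

locale contraction_step = complex_cycle k V c E
    for k V and c :: "'a::linorder set \<Rightarrow> 'g::ab_group_add" and E +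
  fixes u v :: 'a and F0 :: "'a set"
  assumes uv: "u < v" and F0: "c F0 \<noteq> 0" "u \<in> F0" "v \<in> F0"
    and minimal: "\<And>S. (\<And>R. bdry V (restr c S) R = 0) \<Longrightarrow> restr c S = (\<lambda>_. 0) \<or> restr c S = c"
    and contracted: "\<And>A R. link_closed k (merge_rel u v E) (contract u v c) A \<Longrightarrow>
        bdry V (restr (contract u v c) A) R = 0"
begin

abbreviation "E' \<equiv> merge_rel u v E"
abbreviation "uncollapsed F \<equiv> \<not> (u \<in> F \<and> v \<in> F)"

text \<open>The lift of a linkage class of the contracted graph. It goes through merged faces and
  not through the support of the contracted chain, where two faces with the same image may
  cancel.\<close>

definition cls :: "'a set \<Rightarrow> 'a set set" where
  "cls F = {F'. c F' \<noteq> 0 \<and> uncollapsed F' \<and> linked k E' (merge u v ` F) (merge u v ` F')}"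

lemma uvV: "u \<in> V" "v \<in> V"
  using face[OF F0(1)] F0 by auto

lemma Euv: "E u v" "E u u" "E v v"
  using cliques[OF F0(1)] F0 by (auto simp: clique_def)

lemma merged_face:
  assumes "c F \<noteq> 0" "uncollapsed F"
  shows "card (merge u v ` F) = k" "clique E' (merge u v ` F)"
  using card_merge_image[OF assms(2)] face[OF assms(1)] clique_merge[OF cliques[OF assms(1)]] by auto

lemma contract_face:
  assumes "contract u v c B \<noteq> 0"
  shows "card B = k" "clique E' B"
proof -
  obtain F where "c F \<noteq> 0" "uncollapsed F" "merge u v ` F = B"
    using contract_nonzeroE[of u v c B] assms uv by blast
  then show "card B = k" "clique E' B" using merged_face by blast+
qed

lemma cls_refl: "c F \<noteq> 0 \<Longrightarrow> uncollapsed F \<Longrightarrow> F \<in> cls F"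
  unfolding cls_def using linked_refl[OF merged_face(1) _ merged_face(2)] k by auto

lemma cls_eq:
  assumes F: "c F \<noteq> 0" "uncollapsed F" and F': "F' \<in> cls F"
  shows "cls F' = cls F"
proof -
  have *: "c F' \<noteq> 0" "uncollapsed F'" "linked k E' (merge u v ` F) (merge u v ` F')"
    using F' unfolding cls_def by auto
  have k0: "k > 0" using k by simp
  have "linked k E' (merge u v ` F) B \<longleftrightarrow> linked k E' (merge u v ` F') B" for B
    using linked_trans[OF *(3) _ k0 merged_face[OF *(1,2)]]
      linked_trans[OF linked_sym[OF *(3)] _ k0 merged_face[OF F]] by blast
  then show ?thesis unfolding cls_def by blast
qed

text \<open>On uncollapsed faces \<open>S\<close> is a union of lifted classes, so contraction turns
  the restriction to \<open>S\<close> into the restriction of the contracted chain to a link-closed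
  set, and \<open>contracted\<close> applies.\<close>

lemma contract_restr_cycle:
  assumes S: "\<And>F. c F \<noteq> 0 \<Longrightarrow> uncollapsed F \<Longrightarrow> F \<in> S \<longleftrightarrow> (\<exists>F1\<in>S1. F \<in> cls F1)"
    and S1: "\<And>F1. F1 \<in> S1 \<Longrightarrow> c F1 \<noteq> 0 \<and> uncollapsed F1"
  shows "bdry V (contract u v (restr c S)) R = 0"
proof -
  define A where "A = {B. \<exists>F1\<in>S1. linked k E' (merge u v ` F1) B}"
  have k0: "k > 0" using k by simp
  have "contract u v (restr c S) = restr (contract u v c) A"
  proof (rule contract_restr[OF uv])
    fix F assume F: "c F \<noteq> 0" "uncollapsed F"
    show "F \<in> S \<longleftrightarrow> merge u v ` F \<in> A"
      unfolding S[OF F] A_def cls_def using F by blast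
  qed
  moreover have "link_closed k E' (contract u v c) A"
    unfolding link_closed_def
  proof (intro allI impI)
    fix B B' assume B: "B \<in> A" "contract u v c B \<noteq> 0" "linked k E' B B'"
    then show "B' \<in> A"
      unfolding A_def using linked_trans[OF _ B(3) k0 contract_face[OF B(2)]] by blast
  qed
  ultimately show ?thesis using contracted by simp
qed

lemma cls_contract_cycle:
  assumes "c F \<noteq> 0" "uncollapsed F"
  shows "bdry V (contract u v (restr c (cls F))) R = 0"
  by (rule contract_restr_cycle[of _ "{F}"]) (use assms in auto)

lemma restr_cls_off: "restr c (cls F) F' \<noteq> 0 \<Longrightarrow> F' \<in> cls F \<and> uncollapsed F' \<and> c F' \<noteq> 0"
  unfolding restr_def cls_def by (auto split: if_splits)

text \<open>The lift contains \<open>F\<close> but not \<open>F0\<close>, so minimality gives it a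
  nonzero boundary. A boundary ridge cannot contain both \<open>u\<close> and \<open>v\<close>,
  since no face of the lift does, nor avoid both, since there contraction preserves the boundary; a
  ridge through \<open>v\<close> has a partner through \<open>u\<close>.\<close>

lemma cls_bdry_nonzero:
  assumes F: "c F \<noteq> 0" "uncollapsed F"
  obtains G where "u \<notin> G" "v \<notin> G" "bdry V (restr c (cls F)) (insert u G) \<noteq> 0"
proof -
  let ?a = "restr c (cls F)"
  have "?a F \<noteq> 0" using cls_refl[OF F] F(1) by (simp add: restr_def)
  moreover have "?a F0 \<noteq> c F0" using F0 by (auto simp: restr_def cls_def)
  ultimately have "\<not> (\<forall>R. bdry V ?a R = 0)" using minimal[of "cls F"] by metis
  then obtain R where R: "bdry V ?a R \<noteq> 0" by blast
  have fin: "finite R" using chain_on_bdry_nonzero(1)[OF chain_on_restr[OF chain] finV R] .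
  have cyc: "bdry V (contract u v ?a) R = 0" for R by (rule cls_contract_cycle[OF F])
  note V = finV uvV
  show thesis
  proof (cases "u \<in> R")
    case True
    obtain x where "?a (insert x R) \<noteq> 0" using bdry_nonzeroE[OF R] by blast
    then have "v \<notin> R" using restr_cls_off True by blast
    moreover have "insert u (R - {u}) = R" using True by blast
    ultimately show thesis using that[of "R - {u}"] R by auto
  next
    case u: False
    show thesis
    proof (cases "v \<in> R")
      case True
      then have R': "insert v (R - {v}) = R" by blast
      have "bdry V ?a (insert u (R - {v})) \<noteq> 0"
        using bdry_snd_nonzero[OF V uv _ cyc, of "R - {v}"] u R fin R' by auto
      then show thesis using that[of "R - {v}"] u by blast
    next
      case False
      then show thesis using bdry_contract_off[OF V fin uv u False, of ?a] cyc[of R] R by argo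
    qed
  qed
qed

text \<open>A rigid set of the contracted graph is split at \<open>u\<close> along the common
  neighbours. The last conclusion also captures \<open>insert u (insert v G)\<close> for every
  boundary ridge \<open>insert u G\<close>: this set is collapsed, hence outside the class, yet
  becomes linked to it.\<close>

lemma cls_rigid:
  assumes F: "c F \<noteq> 0" "uncollapsed F"
  obtains X where "rigid_set k E X" "\<And>F'. F' \<in> cls F \<Longrightarrow> F' \<subseteq> X"
    "\<And>G. u \<notin> G \<Longrightarrow> v \<notin> G \<Longrightarrow> bdry V (restr c (cls F)) (insert u G) \<noteq> 0 \<Longrightarrow> insert u (insert v G) \<subseteq> X"
proof -
  let ?a = "restr c (cls F)"
  have k0: "k > 0" using k by simp
  have "finite (cls F)" using finite_support by (rule finite_subset[rotated]) (auto simp: cls_def)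
  then have fin: "finite (image (merge u v) ` cls F)" by simp
  have "linked k E' (merge u v ` F) B" if "B \<in> image (merge u v) ` cls F" for B
    using that unfolding cls_def by blast
  from linked_collect[OF fin k0 merged_face[OF F] this]
  obtain X where X: "rigid_set k E' X" "merge u v ` F \<subseteq> X" "\<Union> (image (merge u v) ` cls F) \<subseteq> X"
    by blast
  have inX: "merge u v x \<in> X" if "F' \<in> cls F" "x \<in> F'" for F' x
    using X(3) that by blast
  have aF: "F' \<in> cls F" if "?a F' \<noteq> 0" for F' using restr_cls_off that by blast
  obtain G where G: "u \<notin> G" "v \<notin> G" "bdry V ?a (insert u G) \<noteq> 0"
    using cls_bdry_nonzero[OF F] by blast
  have off: "uncollapsed F'" if "?a F' \<noteq> 0" for F' using restr_cls_off that by blast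
  obtain W where W: "u \<notin> W" "v \<notin> W" "card W = k - 1" "finite W"
    and nb: "\<And>w. w \<in> W \<Longrightarrow> (\<exists>F'. ?a F' \<noteq> 0 \<and> u \<in> F' \<and> w \<in> F') \<and> (\<exists>F'. ?a F' \<noteq> 0 \<and> v \<in> F' \<and> w \<in> F')"
    using common_neighbours[OF k finV uvV uv chain_on_restr[OF chain] off cls_contract_cycle[OF F] G] by blast
  have in_faces: "x \<in> X" if "?a F' \<noteq> 0" "x \<in> F'" "x \<noteq> v" for F' x
    using inX[OF aF[OF that(1)] that(2)] that(3) by (simp add: merge_def)
  have uX: "u \<in> X"
  proof -
    obtain x where "?a (insert x (insert u G)) \<noteq> 0" using bdry_nonzeroE[OF G(3)] by blast
    then show ?thesis using in_faces uv by blast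
  qed
  have WX: "W \<subseteq> X" using nb W(2) in_faces by blast
  have EW: "E u w \<and> E v w" if "w \<in> W" for w
  proof -
    obtain F1 F2 where "?a F1 \<noteq> 0" "u \<in> F1" "w \<in> F1" "?a F2 \<noteq> 0" "v \<in> F2" "w \<in> F2"
      using nb[OF \<open>w \<in> W\<close>] by blast
    moreover have "clique E F1" "clique E F2"
      using restr_cls_off calculation cliques by blast+
    ultimately show ?thesis unfolding clique_def by blast
  qed
  have "rigid_set k E (insert v X)"
  proof (rule rigid_set_split[OF _ k0 sym X(1) _ _ EW Euv])
    show "u \<noteq> v" using uv by simp
    show "insert u W \<subseteq> X" using uX WX by blast
    show "card (insert u W) = k" using W k by simp
    show "card F = k" "clique E F" "uncollapsed F" "merge u v ` F \<subseteq> X"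
      using face F cliques X(2) by auto
  qed
  moreover have "F' \<subseteq> insert v X" if "F' \<in> cls F" for F'
  proof
    fix x assume "x \<in> F'"
    then show "x \<in> insert v X" using inX[OF that, of x] by (cases "x = v") (simp_all add: merge_def)
  qed
  moreover have "insert u (insert v H) \<subseteq> insert v X"
    if H: "u \<notin> H" "v \<notin> H" "bdry V ?a (insert u H) \<noteq> 0" for H
  proof -
    obtain x where x: "?a (insert x (insert u H)) \<noteq> 0" using bdry_nonzeroE[OF H(3)] by blast
    have "H \<subseteq> X"
    proof
      fix z assume "z \<in> H"
      then show "z \<in> X" using in_faces[OF x, of z] H(2) by blast
    qed
    then show ?thesis using uX by blast
  qed
  ultimately show thesis by (rule that)
qed

lemma cls_linked:
  assumes F: "c F \<noteq> 0" "uncollapsed F" and F': "F' \<in> cls F"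
  shows "linked k E F F'"
proof (rule cls_rigid[OF F])
  fix X assume X: "rigid_set k E X" "\<And>F'. F' \<in> cls F \<Longrightarrow> F' \<subseteq> X"
  show ?thesis unfolding linked_def using X(1) X(2)[OF F'] X(2)[OF cls_refl[OF F]] by blast
qed

text \<open>Group the cofaces of the ridge in \<open>A\<close> by lifted class; since the total is
  nonzero, some class has a nonzero boundary there, and its rigid set contains
  \<open>insert u (insert v G)\<close>. Assumption \<open>K\<close> ensures that all these cofaces
  are uncollapsed and so belong to classes.\<close>

lemma linked_missing_face:
  assumes A: "link_closed k E c A" and G: "u \<notin> G" "v \<notin> G" "bdry V (restr c A) (insert u G) \<noteq> 0"
    and K: "restr c A (insert u (insert v G)) = 0"
  obtains F where "F \<in> A" "c F \<noteq> 0" "linked k E F (insert u (insert v G))"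
proof -
  define f where "f = (\<lambda>x. insert x (insert u G))"
  define U where "U = {x \<in> V - insert u G. restr c A (f x) \<noteq> 0}"
  define t where "t = (\<lambda>x. pm (card {y\<in>insert u G. y < x}) (c (f x)))"
  have U: "c (f x) \<noteq> 0 \<and> f x \<in> A \<and> uncollapsed (f x)" if "x \<in> U" for x
  proof -
    have "x \<noteq> v" using that K by (auto simp: U_def f_def insert_commute)
    then show ?thesis using that uv G by (auto simp: U_def restr_def f_def split: if_splits)
  qed
  have finU: "finite U" using finV by (simp add: U_def)
  have "bdry V (restr c A) (insert u G) = sum t U"
    unfolding bdry_def using finV
    by (intro sum.mono_neutral_cong_right) (auto simp: U_def f_def t_def restr_def)
  also have "\<dots> = (\<Sum>D\<in>(\<lambda>x. cls (f x)) ` U. \<Sum>x\<in>{x\<in>U. cls (f x) = D}. t x)"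
    by (rule sum.image_gen[OF finU])
  finally have "(\<Sum>D\<in>(\<lambda>x. cls (f x)) ` U. \<Sum>x\<in>{x\<in>U. cls (f x) = D}. t x) \<noteq> 0" using G(3) by simp
  then obtain z where z: "z \<in> U" "(\<Sum>x\<in>{x\<in>U. cls (f x) = cls (f z)}. t x) \<noteq> 0"
    using sum.not_neutral_contains_not_neutral by blast
  have fz: "c (f z) \<noteq> 0" "uncollapsed (f z)" "f z \<in> A" using U[OF z(1)] by blast+
  obtain X where X: "rigid_set k E X" "\<And>F'. F' \<in> cls (f z) \<Longrightarrow> F' \<subseteq> X"
    "\<And>G. u \<notin> G \<Longrightarrow> v \<notin> G \<Longrightarrow> bdry V (restr c (cls (f z))) (insert u G) \<noteq> 0 \<Longrightarrow> insert u (insert v G) \<subseteq> X"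
    using cls_rigid[OF fz(1,2)] by blast
  have fzX: "f z \<subseteq> X" using X(2) cls_refl[OF fz(1,2)] by blast
  have sub: "{x\<in>U. cls (f x) = cls (f z)} \<subseteq> V - insert u G" by (auto simp: U_def)
  \<comment> \<open>Faces of one lifted class are linked, so the class stays inside \<open>A\<close>
    and its group contains all its cofaces of the ridge.\<close>
  have mem: "x \<in> U \<and> cls (f x) = cls (f z)" if x: "x \<in> V - insert u G" "f x \<in> cls (f z)" for x
  proof -
    have "c (f x) \<noteq> 0" using x(2) by (simp add: cls_def)
    moreover have "linked k E (f z) (f x)" unfolding linked_def using X(1,2) x(2) fzX by blast
    ultimately have "f x \<in> A" using A fz unfolding link_closed_def by blast
    then show ?thesis
      using x \<open>c (f x) \<noteq> 0\<close> cls_eq[OF fz(1,2) x(2)] by (simp add: U_def restr_def)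
  qed
  have mem': "f x \<in> cls (f z)" if "x \<in> U" "cls (f x) = cls (f z)" for x
    using cls_refl[of "f x"] U[OF that(1)] that(2) by blast
  have "bdry V (restr c (cls (f z))) (insert u G) = (\<Sum>x\<in>{x\<in>U. cls (f x) = cls (f z)}. t x)"
    unfolding bdry_def
  proof (rule sum.mono_neutral_cong_right)
    show "finite (V - insert u G)" using finV by simp
    show "\<forall>x\<in>V - insert u G - {x\<in>U. cls (f x) = cls (f z)}.
        pm (card {y\<in>insert u G. y < x}) (restr c (cls (f z)) (insert x (insert u G))) = 0"
    proof
      fix x assume x: "x \<in> V - insert u G - {x\<in>U. cls (f x) = cls (f z)}"
      then have "f x \<notin> cls (f z)" using mem by blast
      then show "pm (card {y\<in>insert u G. y < x}) (restr c (cls (f z)) (insert x (insert u G))) = 0"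
        by (simp add: restr_def f_def)
    qed
    fix x assume "x \<in> {x\<in>U. cls (f x) = cls (f z)}"
    then have "f x \<in> cls (f z)" using mem' by blast
    then show "pm (card {y\<in>insert u G. y < x}) (restr c (cls (f z)) (insert x (insert u G))) = t x"
      by (simp add: restr_def f_def t_def)
  qed (rule sub)
  then have "insert u (insert v G) \<subseteq> X" using X(3) G z(2) by simp
  then have "linked k E (f z) (insert u (insert v G))" unfolding linked_def using X(1) fzX by blast
  then show thesis using that fz by blast
qed

text \<open>As \<open>c\<close> is a cycle, a boundary ridge through \<open>u\<close> for
  \<open>A\<close> is also one for the complement. The ridge together with \<open>v\<close> is a
  face on at most one of the two sides, and a side where it is not a face has a face linked to it.
  Either way a face of \<open>A\<close> gets linked to a face outside.\<close>

lemma link_closed_bdry: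
  assumes A: "link_closed k E c A"
  shows "bdry V (restr c A) R = 0"
proof -
  have k0: "k > 0" using k by simp
  note V = finV uvV
  \<comment> \<open>Linkage after contraction lifts to linkage under \<open>E\<close>, so on
    uncollapsed faces a link-closed set is a union of lifted classes.\<close>
  have saturated: "F \<in> B \<longleftrightarrow> (\<exists>F1\<in>{F1 \<in> B. c F1 \<noteq> 0 \<and> uncollapsed F1}. F \<in> cls F1)"
    if B: "link_closed k E c B" and F: "c F \<noteq> 0" "uncollapsed F" for B F
  proof
    assume "F \<in> B"
    then show "\<exists>F1\<in>{F1 \<in> B. c F1 \<noteq> 0 \<and> uncollapsed F1}. F \<in> cls F1" using F cls_refl by blast
  next
    assume "\<exists>F1\<in>{F1 \<in> B. c F1 \<noteq> 0 \<and> uncollapsed F1}. F \<in> cls F1"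
    then obtain F1 where F1: "F1 \<in> B" "c F1 \<noteq> 0" "uncollapsed F1" "F \<in> cls F1" by blast
    have "linked k E F1 F" by (rule cls_linked[OF F1(2,3,4)])
    then show "F \<in> B" using B F1 F unfolding link_closed_def by blast
  qed
  have cyc: "bdry V (contract u v (restr c B)) R = 0" if B: "link_closed k E c B" for B R
    by (rule contract_restr_cycle[OF saturated[OF B]]) auto
  have A': "link_closed k E c (- A)"
    using A linked_sym unfolding link_closed_def by blast
  have split: "c = (\<lambda>F. restr c A F + restr c (- A) F)" by (auto simp: restr_def)
  have total: "bdry V (restr c A) R + bdry V (restr c (- A)) R = 0" for R
    using cycle[of R] split bdry_add[of V "restr c A" "restr c (- A)" R] by simp
  have on_u: "bdry V (restr c A) (insert u G) = 0" if G: "u \<notin> G" "v \<notin> G" for G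
  proof (rule ccontr)
    let ?K = "insert u (insert v G)"
    assume nz: "bdry V (restr c A) (insert u G) \<noteq> 0"
    then have nz': "bdry V (restr c (- A)) (insert u G) \<noteq> 0" using total[of "insert u G"] by force
    note R = chain_on_bdry_nonzero[OF chain_on_restr[OF chain] finV nz]
    have finG: "finite G" using R by simp
    have cardK: "card ?K = k" using R G uv k by auto
    have "bdry V (restr c A) (insert v G) \<noteq> 0"
      using bdry_snd_nonzero[OF V uv finG cyc[OF A] G] nz by blast
    then obtain y where "restr c A (insert y (insert v G)) \<noteq> 0" using bdry_nonzeroE by blast
    then have cl_v: "clique E (insert y (insert v G))" using cliques by (auto simp: restr_def split: if_splits)
    obtain x where "restr c A (insert x (insert u G)) \<noteq> 0" using bdry_nonzeroE[OF nz] by blast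
    then have cl_u: "clique E (insert x (insert u G))" using cliques by (auto simp: restr_def split: if_splits)
    \<comment> \<open>\<open>insert u G\<close> lies in one face, \<open>insert v G\<close> in
      another, and \<open>u\<close>, \<open>v\<close> are adjacent in \<open>F0\<close>;
      \<open>?K\<close> itself need not be a face.\<close>
    have clK: "clique E ?K"
      using cl_u cl_v Euv sym unfolding clique_def by blast
    consider "c ?K \<noteq> 0" "?K \<in> A" | "c ?K \<noteq> 0" "?K \<notin> A" | "c ?K = 0" by blast
    then show False
    proof cases
      case 1
      then have "restr c (- A) ?K = 0" by (simp add: restr_def)
      then obtain F where F: "F \<in> - A" "c F \<noteq> 0" "linked k E F ?K"
        using linked_missing_face[OF A' G nz'] by blast
      then show False using A' 1 unfolding link_closed_def by blast
    next
      case 2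
      then have "restr c A ?K = 0" by (simp add: restr_def)
      then obtain F where F: "F \<in> A" "c F \<noteq> 0" "linked k E F ?K"
        using linked_missing_face[OF A G nz] by blast
      then show False using A 2 unfolding link_closed_def by blast
    next
      case 3
      then have 0: "restr c A ?K = 0" "restr c (- A) ?K = 0" by (simp_all add: restr_def)
      obtain F where F: "F \<in> A" "c F \<noteq> 0" "linked k E F ?K"
        using linked_missing_face[OF A G nz 0(1)] by blast
      obtain F' where F': "F' \<in> - A" "c F' \<noteq> 0" "linked k E F' ?K"
        using linked_missing_face[OF A' G nz' 0(2)] by blast
      have "linked k E F F'"
        by (rule linked_trans[OF F(3) linked_sym[OF F'(3)] k0 cardK clK])
      then show False using A F F' unfolding link_closed_def by blast
    qed
  qed
  have on_v: "bdry V (restr c A) (insert v G) = 0" if G: "u \<notin> G" "v \<notin> G" for G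
  proof (rule ccontr)
    assume nz: "bdry V (restr c A) (insert v G) \<noteq> 0"
    have "finite G" using chain_on_bdry_nonzero(1)[OF chain_on_restr[OF chain] finV nz] by simp
    then show False using bdry_snd_nonzero[OF V uv _ cyc[OF A] G] nz on_u[OF G] by blast
  qed
  show ?thesis
  proof (rule bdry_eq_0_from_off[OF finV uvV(2) chain_on_restr[OF chain]])
    show "u \<noteq> v" using uv by simp
    fix R assume R: "\<not> (u \<in> R \<and> v \<in> R)"
    consider "u \<in> R" | "v \<in> R" | "u \<notin> R" "v \<notin> R" by blast
    then show "bdry V (restr c A) R = 0"
    proof cases
      case 1
      then have "insert u (R - {u}) = R" by blast
      then show ?thesis using on_u[of "R - {u}"] R 1 by simp
    next
      case 2
      then have "insert v (R - {v}) = R" by blast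
      then show ?thesis using on_v[of "R - {v}"] R 2 by simp
    next
      case 3
      show ?thesis
      proof (rule ccontr)
        assume nz: "bdry V (restr c A) R \<noteq> 0"
        have "finite R" using chain_on_bdry_nonzero(1)[OF chain_on_restr[OF chain] finV nz] .
        then show False
          using bdry_contract_off[OF V _ uv 3, of "restr c A"] cyc[OF A, of R] nz by argo
      qed
    qed
  qed
qed

end

text \<open>The support shrinks in both cases: each part of a splitting misses a face, and
  contraction loses \<open>F0\<close> while every other face has at most one image. The relation is
  generalized because contraction replaces it by \<open>merge_rel u v E\<close>.\<close>

lemma link_closed_cycle:
  fixes c :: "'a::linorder set \<Rightarrow> 'g::ab_group_add"
  assumes "complex_cycle k V c E" "link_closed k E c A"
  shows "bdry V (restr c A) R = 0"
  using assms
proof (induction "card {F. c F \<noteq> 0}" arbitrary: c E A R rule: less_induct)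
  case less
  interpret complex_cycle k V c E by (rule less.prems)
  show ?case
  proof (cases "\<exists>S. (\<forall>R. bdry V (restr c S) R = 0) \<and> restr c S \<noteq> (\<lambda>_. 0) \<and> restr c S \<noteq> c")
    case True
    then obtain S where S: "\<And>R. bdry V (restr c S) R = 0" "restr c S \<noteq> (\<lambda>_. 0)" "restr c S \<noteq> c" by blast
    have split: "b = (\<lambda>F. restr b S F + restr b (- S) F)" for b :: "'a set \<Rightarrow> 'g" by (auto simp: restr_def)
    have S': "bdry V (restr c (- S)) R = 0" for R
      using cycle[of R] split[of c] S(1)[of R] bdry_add[of V "restr c S" "restr c (- S)" R] by simp
    obtain F1 F2 where F1: "F1 \<in> S" "c F1 \<noteq> 0" and F2: "F2 \<notin> S" "c F2 \<noteq> 0"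
      using S(2,3) by (auto simp: restr_def fun_eq_iff split: if_splits)
    have part: "bdry V (restr (restr c T) A) R = 0"
      if T: "\<And>R. bdry V (restr c T) R = 0" "F \<notin> T" "c F \<noteq> 0" for T F
    proof (rule less.hyps)
      have "{F. restr c T F \<noteq> 0} \<subset> {F. c F \<noteq> 0}"
        using T(2,3) by (auto simp: restr_def split: if_splits)
      then show "card {F. restr c T F \<noteq> 0} < card {F. c F \<noteq> 0}"
        by (rule psubset_card_mono[OF finite_support])
      show "complex_cycle k V (restr c T) E"
        using k finV chain_on_restr[OF chain] T(1) sym cliques
        by unfold_locales (auto simp: restr_def split: if_splits)
      \<comment> \<open>\<open>E\<close> is unchanged, so linkage among the faces of the part is
        inherited from \<open>c\<close>.\<close>
      show "link_closed k E (restr c T) A"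
        using less.prems(2) unfolding link_closed_def restr_def by auto
    qed
    have "restr c A = (\<lambda>F. restr (restr c S) A F + restr (restr c (- S)) A F)"
      by (auto simp: restr_def)
    then show ?thesis
      using part[OF S(1) F2] part[OF S', of F1] F1 by (simp add: bdry_add)
  next
    case minimal: False
    show ?thesis
    proof (cases "\<exists>F. c F \<noteq> 0")
      case False
      then have "restr c A F = 0" for F by (simp add: restr_def)
      then show ?thesis by (simp add: bdry_def)
    next
      case True
      then obtain F0 where F0: "c F0 \<noteq> 0" by blast
      then have "\<not> card F0 \<le> 1" "finite F0" using face[OF F0] k by auto
      then obtain x y where "x \<in> F0" "y \<in> F0" "x \<noteq> y"
        using card_le_Suc0_iff_eq[of F0] by auto
      then obtain u v where uv: "u \<in> F0" "v \<in> F0" "u < v" by (metis linorder_neq_iff)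
      then have uvV: "u \<in> V" "v \<in> V" using face[OF F0] by auto
      define E' where "E' = merge_rel u v E"
      let ?\<gamma> = "contract u v c"
      have lift: "\<exists>F. c F \<noteq> 0 \<and> \<not> (u \<in> F \<and> v \<in> F) \<and> merge u v ` F = B" if "?\<gamma> B \<noteq> 0" for B
        using contract_nonzeroE[OF _ that] uv(3) by blast
      have \<gamma>_face: "B \<subseteq> V \<and> card B = k \<and> clique E' B" if B: "?\<gamma> B \<noteq> 0" for B
      proof -
        obtain F where F: "c F \<noteq> 0" "\<not> (u \<in> F \<and> v \<in> F)" "merge u v ` F = B" using lift[OF B] by blast
        have "B \<subseteq> V" using face[OF F(1)] F(3) uvV by (auto simp: merge_def)
        then show ?thesis
          using face[OF F(1)] F(3) card_merge_image[OF F(2)] clique_merge[OF cliques[OF F(1)], of u v]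
          unfolding E'_def by auto
      qed
      have "complex_cycle k V ?\<gamma> E'"
      proof
        show "k \<ge> 3" "finite V" by (rule k finV)+
        show "chain_on k V ?\<gamma>" using \<gamma>_face unfolding chain_on_def by blast
        show "bdry V ?\<gamma> R = 0" for R by (rule bdry_contract_cycle[OF finV uvV uv(3) chain cycle])
        show "E' y x" if "E' x y" for x y using that sym unfolding E'_def merge_rel_def by blast
        show "clique E' B" if "?\<gamma> B \<noteq> 0" for B using \<gamma>_face[OF that] by blast
      qed
      moreover have "card {B. ?\<gamma> B \<noteq> 0} < card {F. c F \<noteq> 0}"
      proof -
        have "{B. ?\<gamma> B \<noteq> 0} \<subseteq> image (merge u v) ` ({F. c F \<noteq> 0} - {F0})"
        proof
          fix B assume "B \<in> {B. ?\<gamma> B \<noteq> 0}"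
          then obtain F where F: "c F \<noteq> 0" "\<not> (u \<in> F \<and> v \<in> F)" "merge u v ` F = B" using lift by blast
          then have "F \<noteq> F0" using uv by blast
          then show "B \<in> image (merge u v) ` ({F. c F \<noteq> 0} - {F0})" using F by blast
        qed
        then have "card {B. ?\<gamma> B \<noteq> 0} \<le> card ({F. c F \<noteq> 0} - {F0})"
          using finite_support by (meson finite_Diff surj_card_le)
        also have "\<dots> < card {F. c F \<noteq> 0}"
          using finite_support F0 by (intro card_Diff1_less) auto
        finally show ?thesis .
      qed
      ultimately have IH: "bdry V (restr ?\<gamma> B) R = 0" if "link_closed k E' ?\<gamma> B" for B R
        using less.hyps[of ?\<gamma> E'] that by blast
      interpret contraction_step k V c E u v F0
      proof
        show "u < v" "c F0 \<noteq> 0" "u \<in> F0" "v \<in> F0" by (rule uv F0)+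
        show "restr c S = (\<lambda>_. 0) \<or> restr c S = c" if "\<And>R. bdry V (restr c S) R = 0" for S
          using minimal that by blast
        show "bdry V (restr ?\<gamma> B) R = 0" if "link_closed k (merge_rel u v E) ?\<gamma> B" for B R
          by (rule IH[unfolded E'_def, OF that])
      qed
      show ?thesis by (rule link_closed_bdry[OF less.prems(2)])
    qed
  qed
qed

section \<open>Rank selection\<close>

text \<open>The double sum is reorganized by the removed vertex, which together with
  \<open>G\<close> determines the face. The global sign arises because \<open>x\<close> itself
  belongs to \<open>{y \<in> F. y \<le> x}\<close>.\<close>

lemma boundary_eq_bdry:
  fixes c :: "'a::linorder set \<Rightarrow> 'g::ab_group_add"
  assumes V: "finite V" and c: "chain_on d V c"
  shows "boundary c G = - bdry V c G"
proof -
  have FV: "F \<subseteq> V \<and> finite F" if "c F \<noteq> 0" for F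
    using c that V finite_subset unfolding chain_on_def by blast
  have fin: "finite (supp c)"
    by (rule finite_subset[of _ "Pow V"]) (use FV V in \<open>auto simp: supp_def\<close>)
  define g where "g = (\<lambda>x. - pm (card {y\<in>G. y < x}) (c (insert x G)))"
  have sc: "signed_coeff F x (c F) = g x" if "F \<in> supp c" "x \<in> F" "F - {x} = G" for F x
  proof -
    have F: "F = insert x G" "x \<notin> G" "finite G"
      using that FV[of F] by (auto simp: supp_def)
    have "{y\<in>F. y \<le> x} = insert x {y\<in>G. y < x}" using F(1,2) by auto
    then have "card {y\<in>F. y \<le> x} = Suc (card {y\<in>G. y < x})" using F(2,3) by simp
    then show ?thesis unfolding signed_coeff_def g_def pm_def F(1)[symmetric] by auto
  qed
  have "boundary c G = (\<Sum>F\<in>supp c. \<Sum>x\<in>V. if x \<in> F \<and> F - {x} = G then g x else 0)"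
    unfolding boundary_def
  proof (rule sum.cong[OF refl])
    fix F assume F: "F \<in> supp c"
    then have "F \<subseteq> V" using FV by (simp add: supp_def)
    then show "(\<Sum>x\<in>F. if F - {x} = G then signed_coeff F x (c F) else 0)
        = (\<Sum>x\<in>V. if x \<in> F \<and> F - {x} = G then g x else 0)"
      using V sc[OF F] by (intro sum.mono_neutral_cong_left) auto
  qed
  also have "\<dots> = (\<Sum>x\<in>V. \<Sum>F\<in>supp c. if x \<in> F \<and> F - {x} = G then g x else 0)"
    by (rule sum.swap)
  also have "\<dots> = (\<Sum>x\<in>V. if x \<notin> G then g x else 0)"
  proof (rule sum.cong[OF refl])
    fix x
    have iff: "x \<in> F \<and> F - {x} = G \<longleftrightarrow> x \<notin> G \<and> F = insert x G" for F by auto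
    show "(\<Sum>F\<in>supp c. if x \<in> F \<and> F - {x} = G then g x else 0) = (if x \<notin> G then g x else 0)"
      unfolding iff using fin by (cases "x \<in> G") (auto simp: supp_def g_def)
  qed
  also have "\<dots> = (\<Sum>x\<in>V - G. g x)"
    using V by (intro sum.mono_neutral_cong_right) auto
  also have "\<dots> = - bdry V c G" by (simp add: g_def bdry_def sum_negf)
  finally show ?thesis .
qed

lemma is_cycle_iff:
  assumes "finite V" "chain_on (Suc i) V c"
  shows "is_cycle i c \<longleftrightarrow> (\<forall>R. bdry V c R = 0)"
proof -
  have F: "F \<subseteq> V \<and> finite F \<and> card F = Suc i" if "c F \<noteq> 0" for F
    using assms that finite_subset unfolding chain_on_def by blast
  have "finite (supp c)"
    by (rule finite_subset[of _ "Pow V"]) (use F assms(1) in \<open>auto simp: supp_def\<close>)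
  then have "is_chain i c" using F by (auto simp: is_chain_def supp_def)
  then show ?thesis unfolding is_cycle_def boundary_eq_bdry[OF assms] by simp
qed

text \<open>The link of \<open>R\<close> in \<open>c\<close>. The exponent counts the pairs
  \<open>r < b\<close>, that is, the inversions when \<open>B\<close> is listed before
  \<open>R\<close>.\<close>

definition link_chain :: "'a::linorder set \<Rightarrow> ('a set \<Rightarrow> 'g::ab_group_add) \<Rightarrow> 'a set \<Rightarrow> 'g" where
  "link_chain R c B =
     (if B \<inter> R = {} then pm (\<Sum>b\<in>B. card {r\<in>R. r < b}) (c (B \<union> R)) else 0)"

text \<open>The position of a new vertex \<open>x\<close> in \<open>S \<union> R\<close> is its
  position in \<open>S\<close> plus the number of \<open>r < x\<close>, and the latter is what
  \<open>x\<close> adds to the exponent of the link. So links of cycles are cycles.\<close>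

lemma bdry_link_chain:
  fixes c :: "'a::linorder set \<Rightarrow> 'g::ab_group_add"
  assumes V: "finite V" and R: "finite R" and S: "finite S" "S \<inter> R = {}"
  shows "bdry V (link_chain R c) S = pm (\<Sum>b\<in>S. card {r\<in>R. r < b}) (bdry V c (S \<union> R))"
proof -
  let ?n = "\<lambda>x. card {r\<in>R. r < x}"
  have "bdry V (link_chain R c) S
      = (\<Sum>x\<in>V - (S \<union> R). pm (\<Sum>b\<in>S. ?n b) (pm (card {y\<in>S \<union> R. y < x}) (c (insert x (S \<union> R)))))"
    unfolding bdry_def
  proof (rule sum.mono_neutral_cong_right)
    show "\<forall>x\<in>V - S - (V - (S \<union> R)). pm (card {y\<in>S. y < x}) (link_chain R c (insert x S)) = 0"
      by (auto simp: link_chain_def)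
    fix x assume x: "x \<in> V - (S \<union> R)"
    have "{y\<in>S \<union> R. y < x} = {y\<in>S. y < x} \<union> {y\<in>R. y < x}" by auto
    then have n: "card {y\<in>S \<union> R. y < x} = card {y\<in>S. y < x} + ?n x"
      using R S by (simp add: card_Un_disjoint disjoint_iff)
    have "insert x S \<inter> R = {}" using x S(2) by auto
    then have "link_chain R c (insert x S) = pm (?n x + (\<Sum>b\<in>S. ?n b)) (c (insert x (S \<union> R)))"
      using x S(1) by (simp add: link_chain_def)
    then show "pm (card {y\<in>S. y < x}) (link_chain R c (insert x S))
        = pm (\<Sum>b\<in>S. ?n b) (pm (card {y\<in>S \<union> R. y < x}) (c (insert x (S \<union> R))))"
      unfolding n by (simp add: pm_pm add.commute add.left_commute)
  qed (use V in auto)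
  then show ?thesis by (simp add: bdry_def pm_sum)
qed

section \<open>Colorings of facets and rank-selected graphs\<close>

lemma proper_coloring_facet:
  assumes "simplicial_complex \<Delta>" "proper_coloring d \<Delta> \<kappa>" "F \<in> \<Delta>" "card F = d" "d > 0"
  shows "inj_on \<kappa> F" "\<kappa> ` F = {1..d}"
proof -
  have fin: "finite F" using assms(4,5) card_ge_0_finite by blast
  have "{x} \<in> \<Delta>" if "x \<in> F" for x
    using assms(1,3) that unfolding simplicial_complex_def by blast
  then have col: "\<kappa> x \<in> {1..d}" if "x \<in> F" for x
    using assms(2) that unfolding proper_coloring_def verts_def by blast
  show inj: "inj_on \<kappa> F"
  proof (rule inj_onI)
    fix x y assume xy: "x \<in> F" "y \<in> F" "\<kappa> x = \<kappa> y"
    have "card {v\<in>F. \<kappa> v = \<kappa> x} \<le> 1"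
      using assms(2,3) col[OF xy(1)] unfolding proper_coloring_def by blast
    then show "x = y" using fin xy card_le_Suc0_iff_eq[of "{v\<in>F. \<kappa> v = \<kappa> x}"] by auto
  qed
  show "\<kappa> ` F = {1..d}"
    using col assms(4) by (intro card_subset_eq) (auto simp: card_image[OF inj])
qed

definition colored :: "('a \<Rightarrow> nat) \<Rightarrow> nat set \<Rightarrow> 'a set \<Rightarrow> 'a set" where
  "colored \<kappa> T F = {x\<in>F. \<kappa> x \<in> T}"

lemma card_colored:
  assumes "inj_on \<kappa> F" "\<kappa> ` F = {1..d}" "T \<subseteq> {1..d}"
  shows "card (colored \<kappa> T F) = card T"
proof -
  have "\<kappa> ` colored \<kappa> T F = T" using assms(2,3) by (auto simp: colored_def)
  moreover have "inj_on \<kappa> (colored \<kappa> T F)"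
    using assms(1) by (rule inj_on_subset) (auto simp: colored_def)
  ultimately show ?thesis using card_image by metis
qed

text \<open>A vertex has a loop exactly if its color is in \<open>T\<close> and it lies on a member
  of the family, so rigid sets for this relation consist of such vertices.\<close>

definition colored_adj :: "('a \<Rightarrow> nat) \<Rightarrow> nat set \<Rightarrow> 'a set set \<Rightarrow> 'a \<Rightarrow> 'a \<Rightarrow> bool" where
  "colored_adj \<kappa> T \<F> x y \<longleftrightarrow> (\<exists>F\<in>\<F>. x \<in> colored \<kappa> T F \<and> y \<in> colored \<kappa> T F)"

lemma clique_colored: "F \<in> \<F> \<Longrightarrow> clique (colored_adj \<kappa> T \<F>) (colored \<kappa> T F)"
  unfolding clique_def colored_adj_def by blast

lemma rigid_if_locked:
  assumes G: "finite_simple_graph G" and lock: "locked k E (fst G) F p"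
    and F: "card F = k" "finite F" "F \<subseteq> fst G" "clique E F" and sp: "spanning k F p"
    and E: "\<And>x y. x \<in> fst G \<Longrightarrow> y \<in> fst G \<Longrightarrow> E x y \<Longrightarrow> x \<noteq> y \<Longrightarrow> {x, y} \<in> snd G"
  shows "rigid k G"
  unfolding rigid_def
proof (intro exI conjI)
  let ?p = "\<lambda>v. vec k (p v)"
  show "framework k G ?p" using G by (simp add: framework_def)
  show "infinitesimally_rigid k G ?p"
    unfolding infinitesimally_rigid_def
  proof (intro allI impI)
    fix q assume q: "infinitesimal_motion k G ?p q"
    then have carr: "q v \<in> carrier_vec k" if "v \<in> fst G" for v
      using that unfolding infinitesimal_motion_def by blast
    have "(\<Sum>i<k. (p x i - p y i) * (q x $ i - q y $ i)) = 0"
      if xy: "x \<in> fst G" "y \<in> fst G" "E x y" for x y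
    proof (cases "x = y")
      case False
      have dims: "dim_vec (q x) = k" "dim_vec (q y) = k" using carr xy by auto
      have "(?p x - ?p y) \<bullet> (q x - q y) = 0"
        using q E[OF xy False] unfolding infinitesimal_motion_def by blast
      moreover have "(?p x - ?p y) \<bullet> (q x - q y) = (\<Sum>i<k. (p x i - p y i) * (q x $ i - q y $ i))"
        unfolding scalar_prod_def using dims by (intro sum.cong) (auto simp: lessThan_atLeast0)
      ultimately show ?thesis by simp
    qed simp
    from locked_motion_trivial[OF lock F sp this]
    obtain S t where S: "skew k S" and qf: "\<And>x i. x \<in> fst G \<Longrightarrow> i < k \<Longrightarrow> q x $ i = flow k S t (p x) i"
      by blast
    show "trivial_motion k G ?p q"
      unfolding trivial_motion_def
    proof (intro bexI conjI ballI)
      let ?S = "mat k k (\<lambda>(i, j). S i j)" and ?t = "vec k t"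
      show "transpose_mat ?S = - ?S"
      proof (rule eq_matI)
        fix i j assume "i < dim_row (- ?S)" "j < dim_col (- ?S)"
        then have ij: "i < k" "j < k" by auto
        then have "S j i = - S i j" using S unfolding skew_def by blast
        then show "transpose_mat ?S $$ (i, j) = (- ?S) $$ (i, j)" using ij by simp
      qed auto
      fix x assume x: "x \<in> fst G"
      show "q x = ?S *\<^sub>v ?p x + ?t"
      proof (rule eq_vecI)
        show "dim_vec (q x) = dim_vec (?S *\<^sub>v ?p x + ?t)" using carr[OF x] by simp
        fix i assume "i < dim_vec (?S *\<^sub>v ?p x + ?t)"
        then have i: "i < k" by simp
        then show "q x $ i = (?S *\<^sub>v ?p x + ?t) $ i"
          using qf[OF x i] by (simp add: flow_def scalar_prod_def lessThan_atLeast0)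
      qed
    qed auto
  qed
qed

lemma rigid_rank_selected:
  assumes \<Delta>: "simplicial_complex \<Delta>" "\<Delta> = generated \<F>"
    and F: "F \<in> \<F>" "card (colored \<kappa> T F) = k" and k: "k > 0"
    and rigid: "rigid_set k (colored_adj \<kappa> T \<F>) (\<Union>F\<in>\<F>. colored \<kappa> T F)"
  shows "rigid k (graph_of (rank_selected \<Delta> \<kappa> T))"
proof -
  let ?E = "colored_adj \<kappa> T \<F>" and ?X = "\<Union>F\<in>\<F>. colored \<kappa> T F"
  let ?G = "graph_of (rank_selected \<Delta> \<kappa> T)"
  have verts: "verts \<Delta> = \<Union>\<F>" unfolding verts_def \<Delta>(2) generated_def by auto
  have fst: "fst ?G = ?X"
    unfolding graph_of_def rank_selected_def induced_def fst_conv verts_def[of "{F \<in> _. _ F}"]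
    using verts by (auto simp: verts_def colored_def)
  have snd: "snd ?G = {e \<in> \<Delta>. e \<subseteq> ?X \<and> card e = 2}"
    unfolding graph_of_def rank_selected_def induced_def snd_conv edges_def verts
    by (auto simp: colored_def)
  have fin: "finite ?X" using rigid unfolding rigid_set_def by blast
  have G: "finite_simple_graph ?G"
    unfolding finite_simple_graph_def fst snd using fin by blast
  have FX: "colored \<kappa> T F \<subseteq> ?X" using F(1) by blast
  from generic_conj[OF rigid_set_locked[OF rigid k FX F(2)] generic_spanning[OF F(2) k]]
  obtain p where p: "locked k ?E ?X (colored \<kappa> T F) p" "spanning k (colored \<kappa> T F) p"
    using generic_ex by blast
  show ?thesis
  proof (rule rigid_if_locked[OF G])
    show "locked k ?E (fst ?G) (colored \<kappa> T F) p" unfolding fst by (rule p(1))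
    show "spanning k (colored \<kappa> T F) p" by (rule p(2))
    show "card (colored \<kappa> T F) = k" by (rule F(2))
    show "finite (colored \<kappa> T F)" using FX fin finite_subset by blast
    show "colored \<kappa> T F \<subseteq> fst ?G" unfolding fst by (rule FX)
    show "clique ?E (colored \<kappa> T F)" by (rule clique_colored[OF F(1)])
    fix x y assume xy: "x \<in> fst ?G" "y \<in> fst ?G" "?E x y" "x \<noteq> y"
    then obtain F' where "F' \<in> \<F>" "{x, y} \<subseteq> F'" unfolding colored_adj_def colored_def by auto
    then have "{x, y} \<in> \<Delta>" unfolding \<Delta>(2) generated_def by blast
    then show "{x, y} \<in> snd ?G" using xy unfolding snd fst by auto
  qed
qed

lemma colored_class_cycle:
  fixes c :: "'a::linorder set \<Rightarrow> 'g::ab_group_add"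
  assumes V: "finite V" and c: "chain_on d V c" and cyc: "\<And>R. bdry V c R = 0"
    and col: "\<And>F. c F \<noteq> 0 \<Longrightarrow> inj_on \<kappa> F \<and> \<kappa> ` F = {1..d}"
    and T: "T \<subseteq> {1..d}" "card T \<ge> 3"
    and A: "A = {F. c F \<noteq> 0 \<and> linked (card T) (colored_adj \<kappa> T {F. c F \<noteq> 0}) B0 (colored \<kappa> T F)}"
  shows "bdry V (restr c A) R = 0"
proof (rule ccontr)
  let ?E = "colored_adj \<kappa> T {F. c F \<noteq> 0}" and ?k = "card T"
  let ?t = "colored \<kappa> T"
  assume nz: "bdry V (restr c A) R \<noteq> 0"
  have k0: "?k > 0" using T(2) by simp
  have face: "F \<subseteq> V \<and> card F = d \<and> finite F" if "c F \<noteq> 0" for F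
    using c V that finite_subset unfolding chain_on_def by blast
  have card_t: "card (?t F) = ?k" if "c F \<noteq> 0" for F
    using card_colored col[OF that] T(1) by blast
  have clique_t: "clique ?E (?t F)" if "c F \<noteq> 0" for F
    by (rule clique_colored) (use that in simp)
  have finR: "finite R" using chain_on_bdry_nonzero(1)[OF chain_on_restr[OF c] V nz] .
  obtain x0 where x0: "x0 \<in> V" "x0 \<notin> R" "restr c A (insert x0 R) \<noteq> 0" using bdry_nonzeroE[OF nz] by blast
  then have F1: "insert x0 R \<in> A" "c (insert x0 R) \<noteq> 0" by (auto simp: restr_def split: if_splits)
  \<comment> \<open>A facet has every color once, so the colors of \<open>R\<close> determine the
    one color that a coface can add.\<close>
  have color: "\<kappa> x = \<kappa> x0" if x: "x \<notin> R" "c (insert x R) \<noteq> 0" for x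
  proof -
    have "\<kappa> ` R = {1..d} - {\<kappa> x}" if "x \<notin> R" "c (insert x R) \<noteq> 0" for x
      using col[OF that(2)] that(1) by (auto simp: inj_on_def)
    from this[OF x] this[OF x0(2) F1(2)] show ?thesis
      using col[OF x(2)] col[OF F1(2)] by blast
  qed
  show False
  proof (cases "\<kappa> x0 \<in> T")
    case False
    \<comment> \<open>All cofaces of \<open>R\<close> share the \<open>T\<close>-colored part of
      \<open>R\<close>, so all of them are in the class.\<close>
    have "restr c A (insert x R) = c (insert x R)" if x: "x \<notin> R" for x
    proof (cases "c (insert x R) = 0")
      case c: False
      have "?t (insert x R) = ?t (insert x0 R)"
        using color[OF x c] False by (auto simp: colored_def)
      then have "insert x R \<in> A" using F1(1) c unfolding A by simp
      then show ?thesis by (simp add: restr_def)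
    qed (simp add: restr_def)
    then have "bdry V (restr c A) R = bdry V c R" by (simp add: bdry_def)
    then show False using nz cyc by simp
  next
    case True
    \<comment> \<open>\<open>R'\<close> carries every color outside \<open>T\<close>, so the faces
      of its link are complete \<open>T\<close>-colored parts of facets.\<close>
    define R' where "R' = R - ?t R"
    define S where "S = ?t R"
    have RS: "S \<union> R' = R" "S \<inter> R' = {}" "finite S" "finite R'"
      using finR by (auto simp: S_def R'_def colored_def)
    have R'T: "\<kappa> x \<notin> T" if "x \<in> R'" for x using that by (auto simp: R'_def colored_def)
    have "insert x0 R = ?t (insert x0 R) \<union> R'" "?t (insert x0 R) \<inter> R' = {}"
      using True x0(2) by (auto simp: R'_def colored_def)
    moreover have "finite (?t (insert x0 R))" using finR by (simp add: colored_def)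
    ultimately have cardR': "d = ?k + card R'"
      using face[OF F1(2)] card_t[OF F1(2)] RS(4) card_Un_disjoint by metis
    define L where "L = link_chain R' c"
    have L: "B \<inter> R' = {} \<and> c (B \<union> R') \<noteq> 0 \<and> B \<subseteq> V \<and> card B = ?k \<and> ?t (B \<union> R') = B" if "L B \<noteq> 0" for B
    proof -
      have B: "B \<inter> R' = {}" "c (B \<union> R') \<noteq> 0"
        using that by (auto simp: L_def link_chain_def split: if_splits)
      have finB: "finite B" "B \<subseteq> V" using face[OF B(2)] by auto
      have "card B + card R' = d" using face[OF B(2)] B(1) finB RS(4) card_Un_disjoint by metis
      then have cB: "card B = ?k" using cardR' by simp
      have "?t (B \<union> R') \<subseteq> B" using R'T by (auto simp: colored_def)
      then have "?t (B \<union> R') = B"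
        using card_subset_eq[OF finB(1)] card_t[OF B(2)] cB by simp
      then show ?thesis using B finB cB by blast
    qed
    have cL: "chain_on ?k V L" using L unfolding chain_on_def by blast
    have "complex_cycle ?k V L ?E"
    proof
      show "?k \<ge> 3" "finite V" "chain_on ?k V L" by (rule T V cL)+
      show "bdry V L Q = 0" for Q
      proof (rule ccontr)
        assume Q: "bdry V L Q \<noteq> 0"
        have finQ: "finite Q" using chain_on_bdry_nonzero(1)[OF cL V Q] .
        obtain x where "L (insert x Q) \<noteq> 0" using bdry_nonzeroE[OF Q] by blast
        then have "Q \<inter> R' = {}" using L by blast
        then show False using Q bdry_link_chain[OF V RS(4) finQ, of c] cyc unfolding L_def by simp
      qed
      show "?E y x" if "?E x y" for x y using that unfolding colored_adj_def by blast
      show "clique ?E B" if "L B \<noteq> 0" for B using L[OF that] clique_t by metis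
    qed
    moreover have "link_closed ?k ?E L {B. linked ?k ?E B0 B}"
      unfolding link_closed_def
    proof (intro allI impI)
      fix B B' assume B: "B \<in> {B. linked ?k ?E B0 B}" "L B \<noteq> 0" "linked ?k ?E B B'"
      have "card B = ?k" "clique ?E B" using L[OF B(2)] clique_t[of "B \<union> R'"] by auto
      then show "B' \<in> {B. linked ?k ?E B0 B}" using linked_trans[OF _ B(3) k0] B(1) by blast
    qed
    ultimately have 0: "bdry V (restr L {B. linked ?k ?E B0 B}) S = 0" by (rule link_closed_cycle)
    \<comment> \<open>Membership in \<open>A\<close> depends only on the \<open>T\<close>-colored
      part, which for \<open>B \<union> R'\<close> is \<open>B\<close>; hence restricting commutes
      with taking the link.\<close>
    have "restr L {B. linked ?k ?E B0 B} = link_chain R' (restr c A)"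
    proof
      fix B
      show "restr L {B. linked ?k ?E B0 B} B = link_chain R' (restr c A) B"
      proof (cases "L B = 0")
        case True
        then show ?thesis unfolding L_def by (auto simp: link_chain_def restr_def split: if_splits)
      next
        case False
        note LB = L[OF False]
        then have "B \<union> R' \<in> A \<longleftrightarrow> linked ?k ?E B0 B" unfolding A by simp
        then show ?thesis using LB unfolding L_def by (simp add: link_chain_def restr_def)
      qed
    qed
    then have "bdry V (restr c A) (S \<union> R') = 0"
      using 0 bdry_link_chain[OF V RS(4,3,2), of "restr c A"] by simp
    then show False using nz RS(1) by simp
  qed
qed

theorem theorem4p1:
  fixes \<Delta> :: "'a::linorder set set" and \<kappa> :: "'a \<Rightarrow> nat" and d :: nat
  assumes "d \<ge> 3"
    and "minimal_cycle_complex TYPE('g::ab_group_add) (d - 1) \<Delta>"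
    and "balanced d \<Delta>"
    and "proper_coloring d \<Delta> \<kappa>"
  shows "\<forall>T. T \<subseteq> {1..d} \<and> card T \<ge> 3 \<longrightarrow>
           rigid (card T) (graph_of (rank_selected \<Delta> \<kappa> T))"
proof (intro allI impI)
  fix T assume "T \<subseteq> {1..d} \<and> card T \<ge> 3"
  then have T: "T \<subseteq> {1..d}" "card T \<ge> 3" by auto
  let ?k = "card T" and ?t = "colored \<kappa> T"
  have k0: "?k > 0" using T(2) by simp
  have d: "d > 0" "d - 1 + 1 = d" using assms(1) by auto
  have sc: "simplicial_complex \<Delta>" using assms(2) unfolding minimal_cycle_complex_def by blast
  have col: "inj_on \<kappa> F \<and> \<kappa> ` F = {1..d}" if "F \<in> \<Delta>" "card F = d" for F
    using proper_coloring_facet[OF sc assms(4) that d(1)] by blast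
  have card_t: "card (?t F) = ?k" if "F \<in> \<Delta>" "card F = d" for F
    using card_colored col[OF that] T(1) by blast
  consider F where "card F = d" "\<Delta> = generated {F}"
    | c :: "'a set \<Rightarrow> 'g" where "c \<noteq> (\<lambda>_. 0)" "minimal_cycle (d - 1) c" "\<Delta> = generated (supp c)"
    using assms(2) unfolding minimal_cycle_complex_def d(2) by blast
  then show "rigid ?k (graph_of (rank_selected \<Delta> \<kappa> T))"
  proof cases
    case (1 F)
    then have "F \<in> \<Delta>" by (auto simp: generated_def)
    then have cF: "card (?t F) = ?k" using card_t 1(1) by blast
    have "rigid_set ?k (colored_adj \<kappa> T {F}) (?t F)"
      by (rule rigid_set_clique[OF cF k0 clique_colored]) simp
    then show ?thesis
      by (intro rigid_rank_selected[OF sc 1(2) _ cF k0]) auto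
  next
    case (2 c)
    define V where "V = \<Union>(supp c)"
    have cyc: "is_cycle (d - 1) c" using 2(2) unfolding minimal_cycle_def by blast
    then have supp: "finite (supp c)" "\<And>F. F \<in> supp c \<Longrightarrow> finite F \<and> card F = d"
      using d(2) unfolding is_cycle_def is_chain_def by auto
    have V: "finite V" unfolding V_def using supp by blast
    have c: "chain_on d V c" using supp(2) unfolding chain_on_def V_def supp_def by blast
    have Suc: "Suc (d - 1) = d" using d(1) by simp
    note cycle_iff = is_cycle_iff[of V "d - 1", unfolded Suc, OF V]
    have bdry0: "bdry V c R = 0" for R using cycle_iff[OF c] cyc by blast
    have \<Delta>F: "F \<in> \<Delta> \<and> card F = d" if "c F \<noteq> 0" for F
    proof -
      have "F \<in> supp c" using that by (simp add: supp_def)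
      then show ?thesis using supp(2) unfolding 2(3) generated_def by blast
    qed
    obtain F0 where F0: "c F0 \<noteq> 0" using 2(1) by auto
    let ?E = "colored_adj \<kappa> T {F. c F \<noteq> 0}"
    define A where "A = {F. c F \<noteq> 0 \<and> linked ?k ?E (?t F0) (?t F)}"
    have card_F: "card (?t F) = ?k" if "c F \<noteq> 0" for F using card_t \<Delta>F[OF that] by blast
    have clique_F: "clique ?E (?t F)" if "c F \<noteq> 0" for F by (rule clique_colored) (use that in simp)
    have "bdry V (restr c A) R = 0" for R
      by (rule colored_class_cycle[OF V c bdry0 _ T A_def]) (use col \<Delta>F in blast)
    then have "is_cycle (d - 1) (restr c A)" using cycle_iff[OF chain_on_restr[OF c]] by blast
    moreover have "subchain (restr c A) c" unfolding subchain_def restr_def by auto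
    ultimately have "restr c A = c \<or> restr c A = (\<lambda>_. 0)"
      using 2(2) unfolding minimal_cycle_def by blast
    moreover have "restr c A F0 \<noteq> 0"
      using F0 linked_refl[OF card_F[OF F0] k0 clique_F[OF F0]] by (simp add: A_def restr_def)
    ultimately have "restr c A = c" by auto
    then have "restr c A F = c F" for F by simp
    then have "F \<in> A" if "c F \<noteq> 0" for F using that unfolding restr_def by metis
    then have all: "linked ?k ?E (?t F0) (?t F)" if "c F \<noteq> 0" for F
      using that unfolding A_def by blast
    have fin: "finite (?t ` {F. c F \<noteq> 0})" using supp(1) by (simp add: supp_def)
    have "linked ?k ?E (?t F0) B" if "B \<in> ?t ` {F. c F \<noteq> 0}" for B using all that by auto
    from linked_collect[OF fin k0 card_F[OF F0] clique_F[OF F0] this]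
    obtain X where X: "rigid_set ?k ?E X" "\<Union>(?t ` {F. c F \<noteq> 0}) \<subseteq> X" by blast
    \<comment> \<open>\<open>X\<close> is only known to contain the selected vertices; the loop at
      each of its members shows that there are no others.\<close>
    have "x \<in> \<Union>(?t ` {F. c F \<noteq> 0})" if "x \<in> X" for x
    proof -
      have "?E x x" using X(1) that unfolding rigid_set_def by blast
      then show ?thesis unfolding colored_adj_def by blast
    qed
    then have "X = (\<Union>F\<in>{F. c F \<noteq> 0}. ?t F)" using X(2) by blast
    then show ?thesis
      using X(1) F0 rigid_rank_selected[OF sc _ _ card_F[OF F0] k0, of "{F. c F \<noteq> 0}"] 2(3)
      unfolding supp_def by simp
  qed
qed

end
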